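(* Let $n \geq 2$, let $f:S^{n-1} \to \{0,1\}$ be measurable, let $0 \leq \rho < 1$, and let $(\mathbf{x},\mathbf{y})$ be $\rho$-correlated points on the unit sphere $S^{n-1} \subseteq \mathbb{R}^n$. Let $\eta$ be a halfspace such that $\mathbb{E}_{\mathbf{x} \sim S^{n-1}}[1_{\eta}(\mathbf{x})] = \mathbb{E}_{\mathbf{x} \sim S^{n-1}}[f(\mathbf{x})]$, where $1_\eta$ is the indicator of $\eta$ and $\mathbf{x}\sim S^{n-1}$ denotes a uniformly random point of $S^{n-1}$. Then \[ -H(f(\mathbf{x}) \mid \mathbf{y}) \leq -H(1_{\eta}(\mathbf{x}) \mid \mathbf{y}). \]
   Context: $\rho$-correlated points on $S^{n-1}$: $\mathbf{x}$ is uniformly distributed on $S^{n-1}$ and $\mathbf{y}$ is the first point of $S^{n-1}$ hit by a standard $n$-dimensional Brownian motion started at $\rho\mathbf{x}$ (equivalently, the result of running Brownian motion on $S^{n-1}$ for time $\ln(1/\rho)$ started at $\mathbf{x}$). Equivalently, for $g:S^{n-1}\to\mathbb{R}$, $P_\rho g(x) := \mathbb{E}[g(\mathbf{y}) \mid \mathbf{x} = x] = \mathbb{E}_{\mathbf{y} \sim S^{n-1}}[P_\rho(x,\mathbf{y}) g(\mathbf{y})]$ with Poisson kernel $P_\rho(x,y) = \frac{1-\rho^2}{\|x-\rho y\|^n}$. For $\beta\in[0,1]$, $h(\beta) = \beta\log_2(1/\beta) + (1-\beta)\log_2(1/(1-\beta))$. For $\{0,1\}$-valued $g$, $H(g(\mathbf{x})\mid\mathbf{y})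 = \mathbb{E}_{\mathbf{y}}[h(\Pr[g(\mathbf{x})=1\mid \mathbf{y}])]$, and $-H(g(\mathbf{x})\mid\mathbf{y}) = \mathbb{E}_{\mathbf{x}\sim S^{n-1}}[-h(P_\rho g(\mathbf{x}))]$. A halfspace is a set $\{x \in \mathbb{R}^n : \langle a,x\rangle \geq t\}$ with $a\neq 0$, $t\in\mathbb{R}$. *)

theory Defs
  imports "HOL-Analysis.Analysis"
begin

text \<open>Uniform (normalized surface) probability measure on the unit sphere
  S^{n-1} of real^'n, realised as the cone measure: the push-forward of the
  uniform probability measure on the open unit ball under x \<mapsto> x / |x|.
  (The point 0 is a null set, so the measure is concentrated on sphere 0 1.)\<close>
definition sphere_measure :: "(real^'n) measure" where
  "sphere_measure = distr (uniform_measure lborel (ball 0 1)) borel (\<lambda>x. x /\<^sub>R norm x)"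

definition poisson_kernel :: "real \<Rightarrow> real^'n \<Rightarrow> real^'n \<Rightarrow> real" where
  "poisson_kernel \<rho> x y = (1 - \<rho>\<^sup>2) / norm (x - \<rho> *\<^sub>R y) ^ CARD('n)"

definition noise_op :: "real \<Rightarrow> (real^'n \<Rightarrow> real) \<Rightarrow> real^'n \<Rightarrow> real" where
  "noise_op \<rho> g x = (\<integral>y. poisson_kernel \<rho> x y * g y \<partial>sphere_measure)"

text \<open>Binary entropy h(beta) (base 2); note log 2 0 = 0 in Isabelle, so h 0 = h 1 = 0.\<close>
definition bin_entropy :: "real \<Rightarrow> real" where
  "bin_entropy \<beta> = \<beta> * log 2 (1 / \<beta>) + (1 - \<beta>) * log 2 (1 / (1 - \<beta>))"

text \<open>H(g(x) | y) for rho-correlated (x,y): E_y [h(Pr[g(x)=1 | y])], where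
  Pr[g(x)=1 | y] = P_rho g(y) (the Poisson kernel is symmetric).\<close>
definition cond_entropy :: "real \<Rightarrow> (real^'n \<Rightarrow> real) \<Rightarrow> real" where
  "cond_entropy \<rho> g = (\<integral>y. bin_entropy (noise_op \<rho> g y) \<partial>sphere_measure)"

definition halfspace :: "(real^'n) set \<Rightarrow> bool" where
  "halfspace \<eta> \<longleftrightarrow> (\<exists>a t. a \<noteq> 0 \<and> \<eta> = {x. inner a x \<ge> t})"

end

theory Submission
  imports Defs "HOL-Probability.Probability"
begin

text \<open>
  For a vector \<open>u\<close>, polarization moves the part of a set \<open>A\<close> that has no mirror image in \<open>A\<close> to the side
  \<open>u \<bullet> x \<ge> 0\<close>. Since the Poisson kernel decreases with the distance, the pair of values of the noise
  operator at \<open>x\<close> and at its mirror image keeps its sum and spreads out, so by concavity of the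
  entropy polarization does not increase the conditional entropy. If \<open>A\<close> has the measure of the cap
  \<open>C\<close> and \<open>A - C\<close> has measure \<open>\<delta>\<close>, then averaging over all reflections gives one that maps a set of
  measure at least \<open>c \<delta>\<^sup>2\<close> from \<open>A - C\<close> into \<open>C - A\<close>, and the corresponding polarization decreases \<open>\<delta>\<close>
  by that much. So iterated polarizations of \<open>A\<close> converge to \<open>C\<close>, and the entropy is continuous along
  this sequence. That the noise operator takes values in \<open>[0,1]\<close>, where the entropy is concave, needs
  the normalization of the Poisson kernel; with \<open>t = x \<bullet> y\<close> and \<open>D = |x - r y|\<^sup>2 = 1 + r\<^sup>2 - 2 r t\<close> it is
  the combination \<open>2 (1 - r t) D powr (- n/2) - D powr (1 - n/2)\<close> of a solid angle density and a
  Newtonian potential, each of which integrates to 1 because the integral solves an ordinary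
  differential equation in \<open>r\<close>.
\<close>

section \<open>A well-ordered copy of a finite index type\<close>

text \<open>The change of variables theorems of \<^theory>\<open>HOL-Analysis.Change_Of_Vars\<close> need a
  well-ordered index type; they are transported to an arbitrary finite one through this copy.\<close>
typedef 'a well = "UNIV :: 'a set" morphisms unwell well ..

text \<open>The order on the copy is pulled back from the naturals along an arbitrary injection,
  which makes it well-founded.\<close>

definition finite_index :: "'a::finite \<Rightarrow> nat" where
  "finite_index = (SOME f. inj f)"

lemma inj_finite_index: "inj (finite_index :: 'a::finite \<Rightarrow> nat)"
proof -
  have "\<exists>f::'a \<Rightarrow> nat. inj f"
    using finite_imp_inj_to_nat_seg[of "UNIV :: 'a set"] by auto
  then show ?thesis unfolding finite_index_def by (rule someI_ex)
qed

lemma bij_well: "bij well"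
  by (rule bij_betw_byWitness[where f' = unwell]) (auto simp: well_inverse unwell_inverse)

instance well :: (finite) finite
proof
  have "(UNIV :: 'a well set) = range well"
    using bij_is_surj[OF bij_well] by (rule sym)
  moreover have "finite (range (well :: 'a \<Rightarrow> 'a well))" by simp
  ultimately show "finite (UNIV :: 'a well set)" by (rule ssubst)
qed

instantiation well :: (finite) ord
begin

definition less_eq_well :: "'a well \<Rightarrow> 'a well \<Rightarrow> bool" where
  "x \<le> y \<longleftrightarrow> finite_index (unwell x) \<le> finite_index (unwell y)"

definition less_well :: "'a well \<Rightarrow> 'a well \<Rightarrow> bool" where
  "x < y \<longleftrightarrow> finite_index (unwell x) < finite_index (unwell y)"

instance ..
end

instance well :: (finite) linorder
proof
  fix x y z :: "'a well"
  show "x < y \<longleftrightarrow> x \<le> y \<and> \<not> y \<le> x" by (simp only: less_eq_well_def less_well_def) linarith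
  show "x \<le> x" by (simp only: less_eq_well_def)
  show "x \<le> y \<Longrightarrow> y \<le> z \<Longrightarrow> x \<le> z" by (simp only: less_eq_well_def)
  show "x \<le> y \<or> y \<le> x" by (simp only: less_eq_well_def) linarith
  show "x = y" if "x \<le> y" "y \<le> x"
  proof -
    have "finite_index (unwell x) = finite_index (unwell y)"
      using that by (simp only: less_eq_well_def)
    then show ?thesis using injD[OF inj_finite_index] unwell_inject by blast
  qed
qed

instance well :: (finite) wellorder
proof
  fix P and a :: "'a well"
  assume step: "\<And>x :: 'a well. (\<And>y. y < x \<Longrightarrow> P y) \<Longrightarrow> P x"
  show "P a"
  proof (induction "finite_index (unwell a)" arbitrary: a rule: less_induct)
    case less
    show ?case by (rule step, rule less, simp only: less_well_def)
  qed
qed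

definition to_well :: "real^'n \<Rightarrow> real^'n well" where
  "to_well x = (\<chi> i. x $ unwell i)"

definition of_well :: "real^'n well \<Rightarrow> real^'n" where
  "of_well x = (\<chi> i. x $ well i)"

lemma of_well_to_well [simp]: "of_well (to_well x) = x"
  and to_well_of_well [simp]: "to_well (of_well y) = y"
  by (simp_all add: of_well_def to_well_def vec_eq_iff well_inverse unwell_inverse)

lemma inner_to_well [simp]: "to_well x \<bullet> to_well y = x \<bullet> (y :: real^'n)"
proof -
  have "(\<Sum>i\<in>UNIV. x $ unwell i * y $ unwell i) = (\<Sum>i\<in>UNIV. x $ i * y $ i)"
    by (rule sum.reindex_bij_witness[where i = well and j = unwell])
      (auto simp: well_inverse unwell_inverse)
  then show ?thesis by (simp add: inner_vec_def to_well_def)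
qed

lemma norm_to_well [simp]: "norm (to_well x) = norm (x :: real^'n)"
  by (simp add: norm_eq_sqrt_inner)

lemma linear_to_well: "linear to_well"
  by (auto intro!: linearI simp: to_well_def vec_eq_iff)

lemma linear_of_well: "linear of_well"
  by (auto intro!: linearI simp: of_well_def vec_eq_iff)

lemma norm_of_well [simp]: "norm (of_well x) = norm (x :: real^('n::finite) well)"
  by (metis norm_to_well to_well_of_well)

lemma measurable_to_well [measurable]: "to_well \<in> borel_measurable borel"
  by (intro borel_measurable_continuous_onI linear_continuous_on)
    (simp add: linear_linear linear_to_well)

lemma measurable_of_well [measurable]: "of_well \<in> borel_measurable borel"
  by (intro borel_measurable_continuous_onI linear_continuous_on)
    (simp add: linear_linear linear_of_well)

text \<open>Relabelling coordinates takes boxes to boxes and only permutes the side lengths, and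
  Lebesgue measure is determined by its values on boxes.\<close>

lemma distr_lborel_to_well: "distr lborel borel (to_well :: real^'n \<Rightarrow> _) = lborel"
proof (rule lborel_eqI[symmetric])
  fix l u :: "real^'n well"
  assume lu: "\<And>b. b \<in> Basis \<Longrightarrow> l \<bullet> b \<le> u \<bullet> b"
  have lu': "l $ i \<le> u $ i" for i using lu[of "axis i 1"] by (simp add: inner_axis)
  have "to_well -` box l u = box (of_well l) (of_well u)"
  proof (intro set_eqI)
    fix x
    have "x \<in> to_well -` box l u \<longleftrightarrow> (\<forall>i. l $ i < x $ unwell i \<and> x $ unwell i < u $ i)"
      by (simp add: mem_box_cart to_well_def)
    also have "\<dots> \<longleftrightarrow> (\<forall>i. l $ well i < x $ i \<and> x $ i < u $ well i)"
      by (metis well_inverse unwell_inverse UNIV_I)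
    finally show "x \<in> to_well -` box l u \<longleftrightarrow> x \<in> box (of_well l) (of_well u)"
      by (simp add: mem_box_cart of_well_def)
  qed
  then have "emeasure (distr lborel borel to_well) (box l u)
      = emeasure lborel (box (of_well l) (of_well u))"
    by (simp add: emeasure_distr)
  also have "\<dots> = (\<Prod>b\<in>Basis. (of_well u - of_well l) \<bullet> b)"
    by (subst emeasure_lborel_box_eq)
      (auto simp: Basis_vec_def inner_axis of_well_def lu' inner_diff_left)
  also have "(\<Prod>b\<in>Basis. (of_well u - of_well l) \<bullet> b) = (\<Prod>i\<in>UNIV. u $ well i - l $ well i)"
    by (simp add: Basis_vec_def UNION_singleton_eq_range prod.reindex inj_on_def axis_eq_axis
        inner_axis inner_diff_left of_well_def)
  also have "\<dots> = (\<Prod>i\<in>UNIV. u $ i - l $ i)"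
    by (rule prod.reindex_bij_witness[where i = unwell and j = well])
      (auto simp: well_inverse unwell_inverse)
  also have "\<dots> = (\<Prod>b\<in>Basis. (u - l) \<bullet> b)"
    by (simp add: Basis_vec_def UNION_singleton_eq_range prod.reindex inj_on_def axis_eq_axis
        inner_axis inner_diff_left)
  finally show "emeasure (distr lborel borel to_well) (box l u) = (\<Prod>b\<in>Basis. (u - l) \<bullet> b)" .
qed simp

lemma measure_lborel_of_well_vimage:
  fixes S :: "(real^'n) set"
  assumes [measurable]: "S \<in> sets borel"
  shows "measure lborel (of_well -` S) = measure lborel S"
proof -
  have V: "of_well -` S \<in> sets borel"
    using measurable_sets[OF measurable_of_well assms] by simp
  have "measure lborel (of_well -` S) = measure (distr lborel borel to_well) (of_well -` S)"
    by (simp only: distr_lborel_to_well)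
  also have "\<dots> = measure lborel (to_well -` of_well -` S \<inter> space lborel)"
    using V by (intro measure_distr) simp_all
  also have "to_well -` of_well -` S \<inter> space lborel = S" by auto
  finally show ?thesis .
qed

section \<open>Reflections and the uniform measure on the sphere\<close>

text \<open>The normal \<open>u\<close> need not have length one. For \<open>u = 0\<close> the
  quotient is 0 and the map is the identity, which is still an orthogonal involution.\<close>

definition reflection :: "'a::euclidean_space \<Rightarrow> 'a \<Rightarrow> 'a" where
  "reflection u x = x - (2 * (u \<bullet> x) / (u \<bullet> u)) *\<^sub>R u"

lemma reflection_zero [simp]: "reflection 0 x = x"
  by (simp add: reflection_def)

lemma reflection_uminus [simp]: "reflection (- u) x = reflection u x"
  by (simp add: reflection_def)

lemma reflection_scaleR: "c \<noteq> 0 \<Longrightarrow> reflection (c *\<^sub>R u) x = reflection u x"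
  by (simp add: reflection_def)

lemma inner_reflection: "u \<bullet> reflection u x = - (u \<bullet> x)"
  by (cases "u = 0") (simp_all add: reflection_def inner_diff_right)

lemma inner_reflection_right:
  "z \<bullet> reflection u x = z \<bullet> x - 2 * (u \<bullet> x) * (u \<bullet> z) / (u \<bullet> u)"
  by (simp add: reflection_def inner_diff_right inner_commute)

lemma reflection_reflection [simp]: "reflection u (reflection u x) = x"
  using inner_reflection[of u x] by (simp add: reflection_def[of u "reflection u x"])
    (simp add: reflection_def)

lemma inner_reflection_both: "reflection u x \<bullet> reflection u y = x \<bullet> y"
  using inner_reflection_right[of "reflection u x" u y] inner_reflection[of u x]
    inner_reflection_right[of y u x]
  by (simp add: inner_commute mult.commute)

lemma norm_reflection [simp]: "norm (reflection u x) = norm x"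
  by (simp add: norm_eq_sqrt_inner inner_reflection_both)

lemma reflection_eq_self: "u \<bullet> x = 0 \<Longrightarrow> reflection u x = x"
  by (simp add: reflection_def)

lemma linear_reflection: "linear (reflection u)"
  by (rule linearI) (simp_all add: reflection_def inner_add_right add_divide_distrib
      scaleR_add_left scaleR_diff_right ring_distribs ac_simps)

lemma orthogonal_transformation_reflection: "orthogonal_transformation (reflection u)"
  unfolding orthogonal_transformation using linear_reflection norm_reflection by blast

lemma measurable_reflection [measurable]:
  assumes [measurable]: "f \<in> borel_measurable M" "g \<in> borel_measurable M"
  shows "(\<lambda>x. reflection (f x) (g x)) \<in> borel_measurable M"
  unfolding reflection_def by measurable

text \<open>Equal norms give |x - y|^2 = 2 (x - y) . x, so the coefficient of the normal
  \<open>x - y\<close> is exactly 1. Any point of a sphere can thus be reflected to any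
  other.\<close>

lemma reflection_swaps:
  fixes x y :: "'a::euclidean_space"
  assumes "norm x = norm y" shows "reflection (x - y) x = y"
proof (cases "x = y")
  case False
  have "x \<bullet> x = y \<bullet> y" using assms by (simp add: norm_eq)
  then have "(x - y) \<bullet> (x - y) = 2 * ((x - y) \<bullet> x)"
    by (simp add: inner_diff_left inner_diff_right inner_commute)
  moreover have "(x - y) \<bullet> (x - y) \<noteq> 0" using False by simp
  ultimately have "2 * ((x - y) \<bullet> x) / ((x - y) \<bullet> (x - y)) = 1"
    by (metis divide_self)
  then show ?thesis unfolding reflection_def by (simp only: scaleR_one) simp
qed simp

lemma borel_measurable_orthogonal_transformation:
  fixes T :: "'a::euclidean_space \<Rightarrow> 'a"
  assumes "orthogonal_transformation T" shows "T \<in> borel_measurable borel"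
  using assms by (intro borel_measurable_continuous_onI linear_continuous_on)
    (simp add: linear_linear orthogonal_transformation_linear)

lemma measurable_direction [measurable]: "(\<lambda>x::real^'n. x /\<^sub>R norm x) \<in> borel_measurable borel"
  by measurable

section \<open>Orthogonal invariance of the uniform measure\<close>

lemma sets_sphere_measure [simp, measurable_cong]: "sets sphere_measure = sets borel"
  by (simp add: sphere_measure_def)

lemma space_sphere_measure [simp]: "space sphere_measure = UNIV"
  by (simp add: sphere_measure_def)

lemma emeasure_unit_ball: "emeasure lborel (ball (0::real^'n) 1) \<noteq> 0" "emeasure lborel (ball (0::real^'n) 1) \<noteq> \<infinity>"
  using emeasure_lborel_ball_finite[of "0::real^'n" 1] content_ball_pos[of 1 "0::real^'n"]
  by (auto simp: measure_def)

lemma prob_space_sphere_measure: "prob_space (sphere_measure :: (real^'n) measure)"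
  unfolding sphere_measure_def
  by (intro prob_space.prob_space_distr prob_space_uniform_measure emeasure_unit_ball) measurable

interpretation sphere: prob_space "sphere_measure :: (real^'n) measure"
  by (rule prob_space_sphere_measure)

text \<open>Turns a claim about the sphere into one about volumes of truncated cones, where linear
  and differentiable changes of variables apply.\<close>

lemma measure_sphere_measure:
  fixes A :: "(real^'n) set"
  assumes [measurable]: "A \<in> sets borel"
  shows "measure sphere_measure A =
    measure lborel {x \<in> ball 0 1. x /\<^sub>R norm x \<in> A} / measure lborel (ball (0::real^'n) 1)"
proof -
  have "measure sphere_measure A =
      measure (uniform_measure lborel (ball 0 1)) ((\<lambda>x. x /\<^sub>R norm x) -` A)"
    unfolding sphere_measure_def by (subst measure_distr) auto
  also have "\<dots> = measure lborel (ball 0 1 \<inter> (\<lambda>x. x /\<^sub>R norm x) -` A) / measure lborel (ball (0::real^'n) 1)"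
    using measurable_sets[OF measurable_direction assms]
    by (intro measure_uniform_measure emeasure_unit_ball) simp
  also have "ball 0 1 \<inter> (\<lambda>x. x /\<^sub>R norm x) -` A = {x \<in> ball 0 1. x /\<^sub>R norm x \<in> A}" by auto
  finally show ?thesis .
qed

lemma AE_sphere_measure_norm: "AE x in sphere_measure. norm (x::real^'n) = 1"
proof -
  have "AE x in lborel. x \<noteq> (0::real^'n)" by (rule AE_lborel_singleton)
  then have "AE x in uniform_measure lborel (ball 0 1). norm (x /\<^sub>R norm (x::real^'n)) = 1"
    by (intro AE_uniform_measureI) auto
  then show ?thesis
    unfolding sphere_measure_def by (subst AE_distr_iff) auto
qed

text \<open>Conjugation by the coordinate relabelling gives an orthogonal map \<open>T'\<close> over
  the well-ordered index type, to which \<open>measure_orthogonal_image\<close> applies. Boundedness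
  puts the sets into \<open>lmeasurable\<close>, as that rule asks.\<close>

lemma measure_lborel_orthogonal_vimage:
  fixes T :: "real^'n \<Rightarrow> real^'n"
  assumes T: "orthogonal_transformation T" and [measurable]: "S \<in> sets borel" and S: "bounded S"
  shows "measure lborel (T -` S) = measure lborel S"
proof -
  have m: "T \<in> borel_measurable borel"
    by (rule borel_measurable_orthogonal_transformation[OF T])
  have TS [measurable]: "T -` S \<in> sets borel" using measurable_sets[OF m, of S] by simp
  have V [measurable]: "of_well -` S \<in> sets borel" "of_well -` T -` S \<in> sets borel"
    using measurable_sets[OF measurable_of_well, of S] measurable_sets[OF measurable_of_well TS]
    by simp_all
  define T' where "T' = to_well \<circ> T \<circ> of_well"
  have "linear T'" unfolding T'_def
    by (intro linear_compose linear_to_well linear_of_well orthogonal_transformation_linear T)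
  moreover have nT: "norm (T x) = norm x" for x
    using T by (simp only: orthogonal_transformation)
  ultimately have T': "orthogonal_transformation T'"
    unfolding orthogonal_transformation by (simp add: T'_def)
  have eq: "T' ` (of_well -` T -` S) = of_well -` S"
  proof (intro equalityI subsetI)
    fix z assume z: "z \<in> of_well -` S"
    obtain x where x: "of_well z = T x"
      using orthogonal_transformation_surj[OF T] by (metis surjD)
    then have "z = T' (to_well x)" unfolding T'_def by (simp flip: x)
    moreover have "to_well x \<in> of_well -` T -` S" using z x by simp
    ultimately show "z \<in> T' ` (of_well -` T -` S)" by (rule image_eqI)
  qed (auto simp: T'_def)
  obtain B where B: "\<And>x. x \<in> S \<Longrightarrow> norm x \<le> B" using S by (auto simp: bounded_iff)
  have "norm z \<le> B" if "z \<in> of_well -` T -` S" for z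
    using B[of "T (of_well z)"] that by (simp add: nT)
  then have "bounded (of_well -` T -` S)"
    unfolding bounded_iff by blast
  then have "of_well -` T -` S \<in> lmeasurable"
    using V by (intro bounded_set_imp_lmeasurable) simp_all
  then have "measure lebesgue (T' ` (of_well -` T -` S)) = measure lebesgue (of_well -` T -` S)"
    by (rule measure_orthogonal_image[OF T'])
  then have "measure lborel (of_well -` S) = measure lborel (of_well -` T -` S)"
    using V by (simp only: eq measure_completion sets_lborel)
  then show ?thesis using assms(2) TS by (simp only: measure_lborel_of_well_vimage)
qed

text \<open>An orthogonal map commutes with x -> x / |x| and preserves the ball, so the cone over a
  preimage is the preimage of the cone.\<close>

lemma distr_sphere_measure_orthogonal:
  fixes T :: "real^'n \<Rightarrow> real^'n"
  assumes T: "orthogonal_transformation T"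
  shows "distr sphere_measure borel T = sphere_measure"
proof -
  have m [measurable]: "T \<in> borel_measurable borel"
    by (rule borel_measurable_orthogonal_transformation[OF T])
  have nT: "norm (T x) = norm x" for x using T by (simp add: orthogonal_transformation)
  have sT: "T (c *\<^sub>R x) = c *\<^sub>R T x" for c x
    using T by (simp add: orthogonal_transformation_linear linear_cmul)
  show ?thesis
  proof (rule measure_eqI)
    fix A assume "A \<in> sets (distr sphere_measure borel T)"
    then have A [measurable]: "A \<in> sets borel" by simp
    have TA [measurable]: "T -` A \<in> sets borel" using measurable_sets[OF m A] by simp
    have "measure sphere_measure (T -` A) = measure sphere_measure A"
    proof -
      have "{x \<in> ball 0 1. x /\<^sub>R norm x \<in> T -` A} = T -` {x \<in> ball 0 1. x /\<^sub>R norm x \<in> A}"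
        by (auto simp: nT sT)
      moreover have "measure lborel (T -` {x \<in> ball 0 1. x /\<^sub>R norm x \<in> A})
          = measure lborel {x \<in> ball 0 1. x /\<^sub>R norm x \<in> A}"
        by (rule measure_lborel_orthogonal_vimage[OF T])
           (measurable, rule bounded_subset[OF bounded_ball[of 0 1]], auto)
      ultimately show ?thesis
        by (simp add: measure_sphere_measure)
    qed
    then show "emeasure (distr sphere_measure borel T) A = emeasure sphere_measure A"
      by (simp add: emeasure_distr sphere.emeasure_eq_measure)
  qed simp
qed

lemma integral_sphere_orthogonal:
  fixes T :: "real^'n \<Rightarrow> real^'n" and F :: "real^'n \<Rightarrow> real"
  assumes T: "orthogonal_transformation T" and [measurable]: "F \<in> borel_measurable borel"
  shows "(\<integral>x. F (T x) \<partial>sphere_measure) = (\<integral>x. F x \<partial>sphere_measure)"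
proof -
  have [measurable]: "T \<in> borel_measurable borel"
    by (rule borel_measurable_orthogonal_transformation[OF T])
  have "(\<integral>x. F x \<partial>sphere_measure) = (\<integral>x. F x \<partial>distr sphere_measure borel T)"
    by (simp add: distr_sphere_measure_orthogonal[OF T])
  also have "\<dots> = (\<integral>x. F (T x) \<partial>sphere_measure)"
    by (rule integral_distr) auto
  finally show ?thesis by simp
qed

section \<open>Mirror images of a fixed point in random hyperplanes\<close>

text \<open>Leibniz expansion: n! terms, each a product of n entries. The bound is crude, but any
  finite constant depending only on the dimension serves for the Jacobian below.\<close>

lemma abs_det_le:
  fixes A :: "real^'n^'n"
  assumes "\<And>i j. \<bar>A $ i $ j\<bar> \<le> b"
  shows "\<bar>det A\<bar> \<le> fact CARD('n) * b ^ CARD('n)"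
proof -
  have "\<bar>det A\<bar> \<le> (\<Sum>p | p permutes UNIV. \<bar>of_int (sign p) * (\<Prod>i\<in>UNIV. A $ i $ p i)\<bar>)"
    unfolding det_def by (rule sum_abs)
  also have "\<dots> \<le> (\<Sum>p | p permutes (UNIV :: 'n set). b ^ CARD('n))"
  proof (rule sum_mono)
    fix p :: "'n \<Rightarrow> 'n"
    have "\<bar>of_int (sign p) * (\<Prod>i\<in>UNIV. A $ i $ p i)\<bar> = (\<Prod>i\<in>UNIV. \<bar>A $ i $ p i\<bar>)"
      by (simp add: abs_mult abs_prod sign_def)
    also have "\<dots> \<le> (\<Prod>i\<in>(UNIV :: 'n set). b)"
      by (intro prod_mono) (simp add: assms)
    finally show "\<bar>of_int (sign p) * (\<Prod>i\<in>UNIV. A $ i $ p i)\<bar> \<le> b ^ CARD('n)" by simp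
  qed
  also have "\<dots> = fact CARD('n) * b ^ CARD('n)"
    by (simp add: card_permutations)
  finally show ?thesis .
qed

text \<open>The map \<open>u \<mapsto> |u|\<^sup>2 \<cdot> reflection u x\<close> is a polynomial, and it maps the cone
  \<open>{u. reflection u x \<in> B}\<close> onto the cone over \<open>B\<close>; hence it bounds the volume of the latter.\<close>
lemma content_cone_le_reflecting_directions_well:
  fixes x :: "real^'m::{finite,wellorder}"
  assumes dim: "2 \<le> CARD('m)" and x: "norm x = 1" and B [measurable]: "B \<in> sets borel"
  shows "measure lborel {z \<in> ball 0 1. z /\<^sub>R norm z \<in> B}
    \<le> fact CARD('m) * 6 ^ CARD('m) * measure lborel {u \<in> ball 0 1. reflection u x \<in> B}"
proof -
  let ?C = "fact CARD('m) * 6 ^ CARD('m) :: real"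
  define S where "S = {u \<in> ball 0 1. reflection u x \<in> B}"
  define g where "g u = (u \<bullet> u) *\<^sub>R x - (2 * (u \<bullet> x)) *\<^sub>R u" for u :: "real^'m::_"
  define g' where "g' u h = (2 * (u \<bullet> h)) *\<^sub>R x - (2 * (h \<bullet> x)) *\<^sub>R u - (2 * (u \<bullet> x)) *\<^sub>R h"
    for u h :: "real^'m::_"
  have [measurable]: "S \<in> sets borel" unfolding S_def by measurable
  have Sb: "bounded S" unfolding S_def by (rule bounded_subset[OF bounded_ball[of 0 1]]) auto
  then have S: "S \<in> lmeasurable" by (intro bounded_set_imp_lmeasurable) auto
  have der: "(g has_derivative g' u) (at u within S)" for u
    unfolding g_def g'_def
    by (auto intro!: derivative_eq_intros simp: algebra_simps inner_commute)
  have entry: "matrix (g' u) $ i $ j = 2 * u $ j * x $ i - 2 * x $ j * u $ i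
      - 2 * (u \<bullet> x) * (if i = j then 1 else 0)" for u i j
    by (simp add: matrix_def g'_def inner_axis inner_axis') (simp add: axis_def)
  have bound: "\<bar>det (matrix (g' u))\<bar> \<le> ?C" if "u \<in> S" for u
  proof (rule abs_det_le)
    fix i j
    have u: "norm u \<le> 1" using that by (simp add: S_def)
    have c: "\<bar>u $ k\<bar> \<le> 1" "\<bar>x $ k\<bar> \<le> 1" for k
      using component_le_norm_cart[of u k] component_le_norm_cart[of x k] u x by auto
    have "\<bar>u $ j * x $ i\<bar> \<le> 1" "\<bar>x $ j * u $ i\<bar> \<le> 1"
      using c by (auto simp: abs_mult intro: mult_le_one)
    moreover have "\<bar>u \<bullet> x\<bar> \<le> 1"
      using Cauchy_Schwarz_ineq2[of u x] u x by simp
    \<comment> \<open>The 6 is 2 + 2 + 2, one summand for each term of \<open>entry\<close>.\<close>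
    ultimately show "\<bar>matrix (g' u) $ i $ j\<bar> \<le> 6"
      unfolding entry by (auto simp: abs_if split: if_splits)
  qed
  have "continuous_on UNIV (\<lambda>u. \<bar>det (matrix (g' u))\<bar>)"
    unfolding det_def entry by (intro continuous_intros)
  then have "(\<lambda>u. \<bar>det (matrix (g' u))\<bar>) absolutely_integrable_on cbox (-1) 1"
    using absolutely_integrable_continuous continuous_on_subset subset_UNIV by blast
  moreover have "S \<subseteq> cbox (- 1) 1"
  proof
    fix u assume "u \<in> S"
    then have "\<bar>u $ i\<bar> \<le> 1" for i
      using component_le_norm_cart[of u i] by (simp add: S_def)
    then show "u \<in> cbox (- 1) 1" by (simp add: mem_box_cart abs_le_iff minus_le_iff)
  qed
  ultimately have "(\<lambda>u. \<bar>det (matrix (g' u))\<bar>) absolutely_integrable_on S"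
    using S set_integrable_subset by blast
  then have int: "(\<lambda>u. \<bar>det (matrix (g' u))\<bar>) integrable_on S"
    by (rule set_lebesgue_integral_eq_integral(1))
  have gS: "g ` S \<in> lmeasurable"
    by (rule measurable_bounded_differentiable_image[OF S der int bound])
  have le: "measure lebesgue (g ` S) \<le> ?C * measure lebesgue S"
    by (rule measure_bounded_differentiable_image[OF S der int bound])
  have g_reflection: "g u = (u \<bullet> u) *\<^sub>R reflection u x" for u
    by (cases "u = 0") (simp_all add: g_def reflection_def scaleR_diff_right)
  \<comment> \<open>Only the origin can be missed: a nonzero z in the cone is reached from a
    \<open>u\<close> whose reflection carries \<open>x\<close> to the direction of
    \<open>z\<close>.\<close>
  have sub: "{z \<in> ball 0 1. z /\<^sub>R norm z \<in> B} \<subseteq> insert 0 (g ` S)"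
  proof (clarify, rule ccontr)
    fix z assume z: "z \<in> ball 0 1" "z /\<^sub>R norm z \<in> B" "z \<notin> g ` S" "z \<noteq> 0"
    define y where "y = z /\<^sub>R norm z"
    have y: "norm y = 1" "z = norm z *\<^sub>R y" using z by (simp_all add: y_def)
    obtain v where v: "v \<noteq> 0" "reflection v x = y"
    proof (cases "y = x")
      case True
      \<comment> \<open>The dimension enters here: a nonzero vector orthogonal to \<open>x\<close>
        exists, and reflection in it fixes \<open>x\<close>.\<close>
      obtain v where "v \<noteq> 0" "orthogonal x v"
        using orthogonal_to_vector_exists[of x] dim by auto
      then show thesis using True
        by (intro that[of v]) (auto simp: orthogonal_def inner_commute reflection_eq_self)
    next
      case False
      then show thesis using x y by (intro that[of "x - y"]) (auto simp: reflection_swaps)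
    qed
    \<comment> \<open>The length is chosen so that |u|^2 = |z|, since \<open>g\<close> scales the
      reflected point by |u|^2; then |z| < 1 gives |u| < 1.\<close>
    define u where "u = (sqrt (norm z) / norm v) *\<^sub>R v"
    have u: "norm u = sqrt (norm z)" using v by (simp add: u_def)
    have "reflection u x = y"
      unfolding u_def using v z by (subst reflection_scaleR) auto
    moreover have "u \<bullet> u = norm z" using u by (simp add: dot_square_norm)
    ultimately have "g u = z" using y by (simp add: g_reflection)
    moreover have "u \<in> S"
      using z u \<open>reflection u x = y\<close> by (simp add: S_def y_def)
    ultimately show False using z(3) by blast
  qed
  have "measure lborel {z \<in> ball 0 1. z /\<^sub>R norm z \<in> B}
      = measure lebesgue {z \<in> ball 0 1. z /\<^sub>R norm z \<in> B}"
    by simp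
  also have "\<dots> \<le> measure lebesgue ({0} \<union> g ` S)"
    using sub gS by (intro measure_mono_fmeasurable fmeasurable.Un) (auto intro: bounded_set_imp_lmeasurable)
  also have "\<dots> \<le> measure lebesgue {0 :: real^'m::_} + measure lebesgue (g ` S)"
    using gS by (intro measure_Un_le) auto
  also have "\<dots> = measure lebesgue (g ` S)" by simp
  also have "\<dots> \<le> ?C * measure lborel S" using le by simp
  finally show ?thesis unfolding S_def .
qed

lemma reflection_to_well: "reflection (to_well u) (to_well x) = to_well (reflection u x)"
  by (simp add: reflection_def linear_diff[OF linear_to_well] linear_cmul[OF linear_to_well])

lemma reflection_of_well: "of_well (reflection u (to_well x)) = reflection (of_well u) x"
  using arg_cong[OF reflection_to_well[of "of_well u" x], of of_well] by simp

lemma content_cone_le_reflecting_directions: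
  fixes x :: "real^'n"
  assumes dim: "2 \<le> CARD('n)" and x: "norm x = 1" and B [measurable]: "B \<in> sets borel"
  shows "measure lborel {z \<in> ball 0 1. z /\<^sub>R norm z \<in> B}
    \<le> fact CARD('n) * 6 ^ CARD('n) * measure lborel {u \<in> ball 0 1. reflection u x \<in> B}"
proof -
  have card: "CARD('n well) = CARD('n)"
    using bij_betw_same_card[OF bij_well] by (rule sym)
  have B' [measurable]: "of_well -` B \<in> sets borel"
    using measurable_sets[OF measurable_of_well B] by simp
  have "measure lborel {z \<in> ball 0 1. z /\<^sub>R norm z \<in> of_well -` B}
    \<le> fact CARD('n well) * 6 ^ CARD('n well) *
      measure lborel {u \<in> ball 0 1. reflection u (to_well x) \<in> of_well -` B}"
    using dim x by (intro content_cone_le_reflecting_directions_well) (simp_all add: card B')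
  also have "{z \<in> ball 0 1. z /\<^sub>R norm z \<in> of_well -` B}
      = of_well -` {z \<in> ball 0 1. z /\<^sub>R norm z \<in> B}"
    by (auto simp: linear_cmul[OF linear_of_well])
  also have "{u \<in> ball 0 1. reflection u (to_well x) \<in> of_well -` B}
      = of_well -` {u \<in> ball 0 1. reflection u x \<in> B}"
    by (auto simp: reflection_of_well)
  finally show ?thesis
    by (subst (asm) (1 2) measure_lborel_of_well_vimage) (measurable, simp add: card)
qed

text \<open>A reflection depends only on the direction of its normal, so the admissible normals form
  a cone and the volume estimate can be divided by the volume of the ball. Hence the law of
  \<open>reflection u x\<close> for random \<open>u\<close> dominates a fixed multiple of the
  uniform law.\<close>

lemma sphere_measure_le_reflecting_directions:
  fixes x :: "real^'n"
  assumes dim: "2 \<le> CARD('n)" and x: "norm x = 1" and B [measurable]: "B \<in> sets borel"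
  shows "measure sphere_measure B
    \<le> fact CARD('n) * 6 ^ CARD('n) * measure sphere_measure {u. reflection u x \<in> B}"
proof -
  have "{u \<in> ball 0 1. u /\<^sub>R norm u \<in> {u. reflection u x \<in> B}}
      = {u \<in> ball 0 1. reflection u x \<in> B}"
  proof -
    have "reflection (u /\<^sub>R norm u) x = reflection u x" for u
      by (cases "u = 0") (simp_all add: reflection_scaleR)
    then show ?thesis by simp
  qed
  moreover have "{u. reflection u x \<in> B} \<in> sets borel" by measurable
  ultimately show ?thesis
    using content_cone_le_reflecting_directions[OF assms]
      divide_right_mono[OF content_cone_le_reflecting_directions[OF assms],
        of "measure lborel (ball (0::real^'n) 1)"]
    by (simp add: measure_sphere_measure)
qed

section \<open>The Poisson kernel has integral one\<close>

text \<open>The mean value theorem bounds every difference quotient by the constant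
  \<open>B\<close>, which is integrable over a finite measure, so dominated convergence along
  sequences applies.\<close>

lemma has_real_derivative_integral_parameter:
  fixes F F' :: "real \<Rightarrow> 'a \<Rightarrow> real"
  assumes M: "finite_measure M" and t0: "t0 \<in> {a<..<b}"
    and int: "\<And>t. t \<in> {a<..<b} \<Longrightarrow> integrable M (F t)"
    and meas [measurable]: "F' t0 \<in> borel_measurable M"
    and der: "AE x in M. \<forall>t\<in>{a<..<b}. ((\<lambda>t. F t x) has_real_derivative F' t x) (at t) \<and> \<bar>F' t x\<bar> \<le> B"
  shows "((\<lambda>t. \<integral>x. F t x \<partial>M) has_real_derivative (\<integral>x. F' t0 x \<partial>M)) (at t0)"
proof -
  interpret finite_measure M by (rule M)
  let ?Q = "\<lambda>t x. (F t x - F t0 x) / (t - t0)"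
  have "((\<lambda>t. ((\<integral>x. F t x \<partial>M) - (\<integral>x. F t0 x \<partial>M)) / (t - t0)) \<longlongrightarrow> (\<integral>x. F' t0 x \<partial>M)) (at t0)"
    unfolding tendsto_at_iff_sequentially comp_def
  proof (intro allI impI)
    fix X :: "nat \<Rightarrow> real" assume X: "\<forall>i. X i \<in> UNIV - {t0}" "X \<longlonglongrightarrow> t0"
    \<comment> \<open>Only a tail of the sequence lies in the interval where the bound is available,
      hence the shift by \<open>N\<close>.\<close>
    have "eventually (\<lambda>i. X i \<in> {a<..<b}) sequentially"
      using X(2) t0 by (intro topological_tendstoD) auto
    then obtain N where N: "\<And>i. i \<ge> N \<Longrightarrow> X i \<in> {a<..<b}"
      unfolding eventually_sequentially by blast
    have "(\<lambda>i. \<integral>x. ?Q (X (i + N)) x \<partial>M) \<longlonglongrightarrow> (\<integral>x. F' t0 x \<partial>M)"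
    proof (rule integral_dominated_convergence[where w = "\<lambda>_. B"])
      show "AE x in M. (\<lambda>i. ?Q (X (i + N)) x) \<longlonglongrightarrow> F' t0 x"
        using der
      proof eventually_elim
        case (elim x)
        then have "((\<lambda>t. ?Q t x) \<longlongrightarrow> F' t0 x) (at t0)"
          using t0 by (simp add: has_field_derivative_iff)
        then have "(\<lambda>i. ?Q (X i) x) \<longlonglongrightarrow> F' t0 x"
          using X unfolding tendsto_at_iff_sequentially comp_def by blast
        then show ?case by (rule LIMSEQ_ignore_initial_segment)
      qed
      show "AE x in M. norm (?Q (X (i + N)) x) \<le> B" for i
        using der
      proof eventually_elim
        case (elim x)
        have "norm (F (X (i + N)) x - F t0 x) \<le> B * norm (X (i + N) - t0)"
          using elim t0 N
          by (intro field_differentiable_bound[where S = "{a<..<b}" and f' = "\<lambda>t. F' t x"])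
            (auto intro: has_field_derivative_at_within)
        moreover have "X (i + N) \<noteq> t0" using X(1) by auto
        ultimately show ?case by (simp add: divide_le_eq)
      qed
      show "(\<lambda>x. ?Q (X (i + N)) x) \<in> borel_measurable M" for i
        using int[OF t0] int[OF N, of "i + N"] by (intro borel_measurable_divide borel_measurable_diff) auto
    qed (auto simp: meas)
    moreover have "(\<integral>x. ?Q (X (i + N)) x \<partial>M)
        = ((\<integral>x. F (X (i + N)) x \<partial>M) - (\<integral>x. F t0 x \<partial>M)) / (X (i + N) - t0)" for i
      using int[OF t0] int[OF N, of "i + N"] by simp
    ultimately have "(\<lambda>i. ((\<integral>x. F (X (i + N)) x \<partial>M) - (\<integral>x. F t0 x \<partial>M)) / (X (i + N) - t0))
        \<longlonglongrightarrow> (\<integral>x. F' t0 x \<partial>M)" by (simp only:)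
    then show "(\<lambda>i. ((\<integral>x. F (X i) x \<partial>M) - (\<integral>x. F t0 x \<partial>M)) / (X i - t0))
        \<longlonglongrightarrow> (\<integral>x. F' t0 x \<partial>M)" by (rule LIMSEQ_offset)
  qed
  then show ?thesis by (simp add: has_field_derivative_iff)
qed

section \<open>Plane rotations and the law of one coordinate\<close>

definition plane_rotation :: "'n \<Rightarrow> 'n \<Rightarrow> real \<Rightarrow> real^'n \<Rightarrow> real^'n" where
  "plane_rotation k j \<theta> y =
    y + ((cos \<theta> - 1) * y $ k - sin \<theta> * y $ j) *\<^sub>R axis k 1
      + (sin \<theta> * y $ k + (cos \<theta> - 1) * y $ j) *\<^sub>R axis j 1"

lemma plane_rotation_nth:
  assumes "j \<noteq> k"
  shows "plane_rotation k j \<theta> y $ k = cos \<theta> * y $ k - sin \<theta> * y $ j"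
    and "plane_rotation k j \<theta> y $ j = sin \<theta> * y $ k + cos \<theta> * y $ j"
  using assms by (simp_all add: plane_rotation_def axis_def algebra_simps)

lemma orthogonal_transformation_plane_rotation:
  assumes jk: "j \<noteq> k"
  shows "orthogonal_transformation (plane_rotation k j \<theta>)"
proof -
  have lin: "linear (plane_rotation k j \<theta>)"
    by (rule linearI) (simp_all add: plane_rotation_def vec_eq_iff algebra_simps)
  have "plane_rotation k j \<theta> y \<bullet> plane_rotation k j \<theta> y = y \<bullet> y" for y
  proof -
    define a b p q where "a = y $ k" "b = y $ j"
      "p = (cos \<theta> - 1) * y $ k - sin \<theta> * y $ j" "q = sin \<theta> * y $ k + (cos \<theta> - 1) * y $ j"
    note defs = a_b_p_q_def
    have ax: "axis j 1 $ k = (0::real)" "axis k 1 $ j = (0::real)"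
      using jk by (simp_all add: axis_def)
    have "plane_rotation k j \<theta> y \<bullet> plane_rotation k j \<theta> y
        = y \<bullet> y + 2 * p * a + 2 * q * b + p\<^sup>2 + q\<^sup>2"
      unfolding plane_rotation_def defs(3,4)[symmetric] using jk
      by (simp add: inner_add_left inner_add_right inner_axis inner_axis' inner_axis_axis ax
          defs(1,2)[symmetric] power2_eq_square algebra_simps)
    also have "\<dots> = y \<bullet> y + (a\<^sup>2 + b\<^sup>2) * ((sin \<theta>)\<^sup>2 + (cos \<theta>)\<^sup>2 - 1)"
      unfolding defs(3,4) defs(1,2)[symmetric] by algebra
    finally show ?thesis by simp
  qed
  with lin show ?thesis
    unfolding orthogonal_transformation by (simp add: norm_eq_sqrt_inner)
qed

lemma AE_sphere_nth: "AE y in sphere_measure. \<forall>i. (y :: real^'n) $ i \<in> {-1..1}"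
  using AE_sphere_measure_norm
proof eventually_elim
  case (elim y)
  then show ?case using component_le_norm_cart[of y] by (auto simp: abs_le_iff minus_le_iff)
qed

lemma integrable_sphere_bounded:
  fixes F :: "real^'n \<Rightarrow> real"
  assumes "F \<in> borel_measurable borel" "AE y in sphere_measure. \<bar>F y\<bar> \<le> B"
  shows "integrable sphere_measure F"
  using assms by (intro sphere.integrable_const_bound[where B = B]) auto

text \<open>The \<open>k\<close>-th coordinate of a uniform point has density proportional to
  \<open>(1 - t\<^sup>2) powr ((n - 3) / 2)\<close>; this is the integrated form of that fact, and it is
  obtained by differentiating the rotation invariance of the measure.\<close>
lemma sphere_integral_by_parts:
  fixes k :: "'n::finite" and F F' :: "real \<Rightarrow> real"
  assumes der: "\<And>t. t \<in> {-1..1} \<Longrightarrow> (F has_real_derivative F' t) (at t)"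
    and [measurable]: "F \<in> borel_measurable borel" "F' \<in> borel_measurable borel"
    and B: "\<And>t. t \<in> {-1..1} \<Longrightarrow> \<bar>F t\<bar> \<le> B" "\<And>t. t \<in> {-1..1} \<Longrightarrow> \<bar>F' t\<bar> \<le> B"
  shows "(\<integral>y. (1 - (y $ k)\<^sup>2) * F' (y $ k) - (real CARD('n) - 1) * y $ k * F (y $ k)
    \<partial>(sphere_measure :: (real^'n) measure)) = 0"
proof -
  have B0: "0 \<le> B" using B(1)[of 0] by simp
  have bd: "\<bar>u * F t\<bar> \<le> B" "\<bar>u * F' t\<bar> \<le> B" if "t \<in> {-1..1}" "\<bar>u\<bar> \<le> 1" for t u
    using mult_mono[OF that(2) B(1)[OF that(1)]] mult_mono[OF that(2) B(2)[OF that(1)]]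
    by (simp_all add: abs_mult)
  \<comment> \<open>Rotating in the (k, j)-plane leaves the integral of y_j F(y_k) unchanged. Its
    derivative at angle 0 is the integral of y_k F(y_k) - y_j^2 F'(y_k), which therefore
    vanishes.\<close>
  have part: "(\<integral>y. y $ k * F (y $ k) - (y $ j)\<^sup>2 * F' (y $ k) \<partial>(sphere_measure :: (real^'n) measure)) = 0"
    (is "?I = 0") and part_int: "integrable (sphere_measure :: (real^'n) measure)
      (\<lambda>y. y $ k * F (y $ k) - (y $ j)\<^sup>2 * F' (y $ k))" if jk: "j \<noteq> k" for j
  proof -
    let ?R = "plane_rotation k j"
    let ?G = "\<lambda>\<theta> y. ?R \<theta> y $ j * F (?R \<theta> y $ k)"
    let ?G' = "\<lambda>\<theta> y. ?R \<theta> y $ k * F (?R \<theta> y $ k) - (?R \<theta> y $ j)\<^sup>2 * F' (?R \<theta> y $ k)"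
    have R_nth: "?R \<theta> y $ i \<in> {-1..1}" if "norm y = 1" for \<theta> i and y :: "real^'n"
      using component_le_norm_cart[of "?R \<theta> y" i] that
        orthogonal_transformation_plane_rotation[OF jk, of \<theta>]
      by (auto simp: abs_le_iff minus_le_iff orthogonal_transformation)
    have G': "\<bar>?G' \<theta> y\<bar> \<le> 2 * B" if "norm y = 1" for \<theta> and y :: "real^'n"
    proof -
      have "\<bar>?R \<theta> y $ k\<bar> \<le> 1" "\<bar>(?R \<theta> y $ j)\<^sup>2\<bar> \<le> 1"
        using R_nth[OF that, of \<theta> k] R_nth[OF that, of \<theta> j]
        by (auto simp: abs_le_iff abs_square_le_1)
      from add_mono[OF bd(1)[OF R_nth[OF that, of \<theta> k] this(1)] bd(2)[OF R_nth[OF that, of \<theta> k] this(2)]]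
      show ?thesis by (intro order_trans[OF abs_triangle_ineq4]) linarith
    qed
    have m [measurable]: "(\<lambda>y. ?G \<theta> y) \<in> borel_measurable borel" "(\<lambda>y. ?G' \<theta> y) \<in> borel_measurable borel"
      for \<theta> unfolding plane_rotation_nth[OF jk] by measurable
    have "AE y in sphere_measure. \<bar>?G \<theta> y\<bar> \<le> B" for \<theta>
      using AE_sphere_measure_norm
    proof eventually_elim
      case (elim y)
      have "\<bar>?R \<theta> y $ j\<bar> \<le> 1" using R_nth[OF elim, of \<theta> j] by (auto simp: abs_le_iff)
      then show ?case by (rule bd(1)[OF R_nth[OF elim]])
    qed
    then have G_int: "integrable sphere_measure (?G \<theta>)" for \<theta>
      by (rule integrable_sphere_bounded[OF m(1)])
    have "((\<lambda>\<theta>. \<integral>y. ?G \<theta> y \<partial>sphere_measure) has_real_derivative (\<integral>y. ?G' 0 y \<partial>sphere_measure)) (at 0)"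
    proof (rule has_real_derivative_integral_parameter[where a = "-1" and b = 1 and B = "2 * B"])
      show "AE y in sphere_measure. \<forall>t\<in>{-1<..<1}. ((\<lambda>t. ?G t y) has_real_derivative ?G' t y) (at t)
          \<and> \<bar>?G' t y\<bar> \<le> 2 * B"
        using AE_sphere_measure_norm
      proof eventually_elim
        case (elim y)
        show ?case
        proof (intro ballI conjI)
          fix t
          have 1: "((\<lambda>t. ?R t y $ j) has_real_derivative ?R t y $ k) (at t)"
            and 2: "((\<lambda>t. ?R t y $ k) has_real_derivative - ?R t y $ j) (at t)"
            unfolding plane_rotation_nth[OF jk] by (auto intro!: derivative_eq_intros)
          have 3: "((\<lambda>t. F (?R t y $ k)) has_real_derivative F' (?R t y $ k) * - ?R t y $ j) (at t)"
            by (rule DERIV_chain2[OF der[OF R_nth[OF elim]] 2])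
          show "((\<lambda>t. ?G t y) has_real_derivative ?G' t y) (at t)"
            using DERIV_mult[OF 1 3] by (simp add: power2_eq_square algebra_simps)
          show "\<bar>?G' t y\<bar> \<le> 2 * B" by (rule G'[OF elim])
        qed
      qed
    qed (auto intro!: G_int m simp: sphere.finite_measure_axioms)
    moreover have "(\<integral>y. ?G \<theta> y \<partial>sphere_measure) = (\<integral>y. y $ j * F (y $ k) \<partial>sphere_measure)" for \<theta>
      by (rule integral_sphere_orthogonal[OF orthogonal_transformation_plane_rotation[OF jk],
          where F = "\<lambda>y. y $ j * F (y $ k)"]) measurable
    ultimately have "((\<lambda>_. \<integral>y. y $ j * F (y $ k) \<partial>(sphere_measure :: (real^'n) measure)) has_real_derivative
        (\<integral>y. ?G' 0 y \<partial>sphere_measure)) (at 0)" by simp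
    then have "(\<integral>y. ?G' 0 y \<partial>sphere_measure) = 0"
      using DERIV_unique[OF _ DERIV_const] by blast
    then show "?I = 0" by (simp add: plane_rotation_nth[OF jk])
    have "AE y in sphere_measure. \<bar>?G' 0 y\<bar> \<le> 2 * B"
      using AE_sphere_measure_norm by eventually_elim (rule G')
    then have "integrable sphere_measure (?G' 0)"
      by (rule integrable_sphere_bounded[OF m(2)])
    then show "integrable (sphere_measure :: (real^'n) measure)
      (\<lambda>y. y $ k * F (y $ k) - (y $ j)\<^sup>2 * F' (y $ k))" by (simp add: plane_rotation_nth[OF jk])
  qed
  \<comment> \<open>Summing over all j other than k produces n - 1 copies of the first term, and the
    squares add up to 1 - y_k^2 on the sphere.\<close>
  have "(\<integral>y. (1 - (y $ k)\<^sup>2) * F' (y $ k) - (real CARD('n) - 1) * y $ k * F (y $ k)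
      \<partial>(sphere_measure :: (real^'n) measure))
    = (\<integral>y. - (\<Sum>j\<in>UNIV - {k}. y $ k * F (y $ k) - (y $ j)\<^sup>2 * F' (y $ k))
      \<partial>(sphere_measure :: (real^'n) measure))"
  proof (rule integral_cong_AE)
    show "AE y in (sphere_measure :: (real^'n) measure).
        (1 - (y $ k)\<^sup>2) * F' (y $ k) - (real CARD('n) - 1) * y $ k * F (y $ k)
        = - (\<Sum>j\<in>UNIV - {k}. y $ k * F (y $ k) - (y $ j)\<^sup>2 * F' (y $ k))"
      using AE_sphere_measure_norm
    proof eventually_elim
      case (elim y)
      have "1 = y \<bullet> y" using elim by (simp add: dot_square_norm)
      also have "\<dots> = (\<Sum>j\<in>UNIV. (y $ j)\<^sup>2)" by (simp add: inner_vec_def power2_eq_square)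
      also have "\<dots> = (y $ k)\<^sup>2 + (\<Sum>j\<in>UNIV - {k}. (y $ j)\<^sup>2)" by (rule sum.remove) auto
      finally have "(\<Sum>j\<in>UNIV - {k}. (y $ j)\<^sup>2) = 1 - (y $ k)\<^sup>2" by simp
      moreover have "real (card (UNIV - {k})) = real CARD('n) - 1"
        by (simp add: card_Diff_singleton_if of_nat_diff Suc_leI)
      ultimately show ?case
        by (simp add: sum_subtractf flip: sum_distrib_right)
    qed
  qed measurable
  also have "\<dots> = - (\<Sum>j\<in>UNIV - {k}. \<integral>y. y $ k * F (y $ k) - (y $ j)\<^sup>2 * F' (y $ k)
      \<partial>(sphere_measure :: (real^'n) measure))"
    by (simp only: integral_minus) (subst Bochner_Integration.integral_sum, use part_int in auto)
  also have "\<dots> = 0" using part by simp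
  finally show ?thesis .
qed

section \<open>Solid angle and Newtonian potential integrals\<close>

text \<open>For unit vectors \<open>x\<close>, \<open>y\<close> with \<open>x \<bullet> y = t\<close> this is the squared norm of \<open>x - r y\<close>.\<close>
definition sqdist :: "real \<Rightarrow> real \<Rightarrow> real" where
  "sqdist r t = 1 + r\<^sup>2 - 2 * r * t"

text \<open>For fixed r the minimum is at t = 1 or t = -1, according to the sign of r, and equals (1
  - |r|)^2.\<close>

lemma sqdist_ge:
  assumes "\<bar>r\<bar> \<le> R" "R \<le> 1" "t \<in> {-1..1}"
  shows "(1 - R)\<^sup>2 \<le> sqdist r t"
proof -
  have "\<bar>r * t\<bar> \<le> \<bar>r\<bar>"
    using assms by (simp add: abs_mult abs_le_iff mult_left_le)
  then have "(1 - \<bar>r\<bar>)\<^sup>2 \<le> sqdist r t"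
    by (simp add: sqdist_def power2_eq_square algebra_simps)
  moreover have "(1 - R)\<^sup>2 \<le> (1 - \<bar>r\<bar>)\<^sup>2"
    using assms by (intro power_mono) auto
  ultimately show ?thesis by linarith
qed

lemma sqdist_pos:
  assumes "\<bar>r\<bar> < 1" "t \<in> {-1..1}"
  shows "0 < sqdist r t"
proof -
  have "0 < (1 - \<bar>r\<bar>)\<^sup>2" using assms by simp
  also have "\<dots> \<le> sqdist r t" using assms by (intro sqdist_ge) auto
  finally show ?thesis .
qed

lemma measurable_sqdist [measurable]: "sqdist r \<in> borel_measurable borel"
  unfolding sqdist_def by measurable

lemma DERIV_sqdist_powr_left:
  assumes "\<bar>r\<bar> < 1" "t \<in> {-1..1}"
  shows "((\<lambda>r. sqdist r t powr a) has_real_derivative a * sqdist r t powr (a - 1) * (2 * r - 2 * t)) (at r)"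
proof -
  have "((\<lambda>r. sqdist r t) has_real_derivative 2 * r - 2 * t) (at r)"
    unfolding sqdist_def by (auto intro!: derivative_eq_intros)
  from DERIV_fun_powr[OF this sqdist_pos[OF assms], of a] show ?thesis by simp
qed

lemma DERIV_sqdist_powr_right:
  assumes "\<bar>r\<bar> < 1" "t \<in> {-1..1}"
  shows "((\<lambda>t. sqdist r t powr a) has_real_derivative a * sqdist r t powr (a - 1) * (- 2 * r)) (at t)"
proof -
  have "((\<lambda>t. sqdist r t) has_real_derivative - 2 * r) (at t)"
    unfolding sqdist_def by (auto intro!: derivative_eq_intros)
  from DERIV_fun_powr[OF this sqdist_pos[OF assms], of a] show ?thesis by simp
qed

lemma continuous_on_sqdist_powr:
  assumes "\<bar>R\<bar> < 1"
  shows "continuous_on ({-R..R} \<times> {-1..1}) (\<lambda>z. sqdist (fst z) (snd z) powr a)"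
proof (rule continuous_on_powr)
  show "\<forall>z\<in>{-R..R} \<times> {-1..1}. sqdist (fst z) (snd z) \<noteq> 0"
  proof
    fix z :: "real \<times> real" assume "z \<in> {-R..R} \<times> {-1..1}"
    then have "\<bar>fst z\<bar> < 1" "snd z \<in> {-1..1}"
      using assms by (auto simp: abs_less_iff mem_Times_iff)
    from sqdist_pos[OF this] show "sqdist (fst z) (snd z) \<noteq> 0" by simp
  qed
qed (auto simp: sqdist_def intro!: continuous_intros)

lemma continuous_on_sqdist_powr_right:
  assumes "\<bar>r\<bar> < 1"
  shows "continuous_on {-1..1} (\<lambda>t. sqdist r t powr a)"
proof -
  have "continuous_on {-1..1} (\<lambda>t. sqdist (fst (r, t)) (snd (r, t)) powr a)"
    by (rule continuous_on_compose2[OF continuous_on_sqdist_powr[of "\<bar>r\<bar>"]])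
      (use assms in \<open>auto intro!: continuous_intros\<close>)
  then show ?thesis by simp
qed

text \<open>An R strictly between |r| and 1 makes the domain of (r, t) compact, so continuity
  supplies the uniform bounds that differentiation under the integral asks for.\<close>

lemma has_real_derivative_sphere_integral:
  fixes k :: "'n::finite" and F F' :: "real \<Rightarrow> real \<Rightarrow> real"
  assumes r: "\<bar>r\<bar> < 1"
    and der: "\<And>r t. \<bar>r\<bar> < 1 \<Longrightarrow> t \<in> {-1..1} \<Longrightarrow> ((\<lambda>r. F r t) has_real_derivative F' r t) (at r)"
    and cont: "\<And>R. \<bar>R\<bar> < 1 \<Longrightarrow> continuous_on ({-R..R} \<times> {-1..1}) (\<lambda>z. F (fst z) (snd z))"
      "\<And>R. \<bar>R\<bar> < 1 \<Longrightarrow> continuous_on ({-R..R} \<times> {-1..1}) (\<lambda>z. F' (fst z) (snd z))"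
    and [measurable]: "\<And>r. F r \<in> borel_measurable borel" "\<And>r. F' r \<in> borel_measurable borel"
  shows "((\<lambda>r. \<integral>y. F r (y $ k) \<partial>(sphere_measure :: (real^'n) measure)) has_real_derivative
    (\<integral>y. F' r (y $ k) \<partial>(sphere_measure :: (real^'n) measure))) (at r)"
proof -
  obtain R where R: "\<bar>r\<bar> < R" "R < 1" using dense[OF r] by blast
  have bounded: "\<exists>B. \<forall>s\<in>{-R..R}. \<forall>t\<in>{-1..1}. \<bar>G s t\<bar> \<le> B"
    if "continuous_on ({-R..R} \<times> {-1..1}) (\<lambda>z. G (fst z) (snd z))" for G :: "real \<Rightarrow> real \<Rightarrow> real"
  proof -
    have "compact ((\<lambda>z. G (fst z) (snd z)) ` ({-R..R} \<times> {-1..1}))"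
      by (intro compact_continuous_image that compact_Times compact_Icc)
    then have "bounded ((\<lambda>z. G (fst z) (snd z)) ` ({-R..R} \<times> {-1..1}))" by (rule compact_imp_bounded)
    then show ?thesis unfolding bounded_iff by force
  qed
  have "\<bar>R\<bar> < 1" using R by auto
  obtain A where A: "\<And>s t. s \<in> {-R..R} \<Longrightarrow> t \<in> {-1..1} \<Longrightarrow> \<bar>F s t\<bar> \<le> A"
    using bounded[OF cont(1)[OF \<open>\<bar>R\<bar> < 1\<close>]] by blast
  obtain B where B: "\<And>s t. s \<in> {-R..R} \<Longrightarrow> t \<in> {-1..1} \<Longrightarrow> \<bar>F' s t\<bar> \<le> B"
    using bounded[OF cont(2)[OF \<open>\<bar>R\<bar> < 1\<close>]] by blast
  show ?thesis
  proof (rule has_real_derivative_integral_parameter[where a = "-R" and b = R and B = B])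
    show "r \<in> {-R<..<R}" using R by auto
    show "integrable (sphere_measure :: (real^'n) measure) (\<lambda>y. F s (y $ k))" if s: "s \<in> {-R<..<R}" for s
    proof (rule integrable_sphere_bounded)
      show "AE y in sphere_measure. \<bar>F s ((y :: real^'n) $ k)\<bar> \<le> A"
        using AE_sphere_nth by eventually_elim (rule A, use s in auto)
    qed measurable
    show "AE y in sphere_measure. \<forall>s\<in>{-R<..<R}. ((\<lambda>s. F s ((y :: real^'n) $ k)) has_real_derivative
        F' s (y $ k)) (at s) \<and> \<bar>F' s (y $ k)\<bar> \<le> B"
      using AE_sphere_nth
    proof eventually_elim
      case (elim y)
      show ?case
      proof (intro ballI conjI)
        fix s assume s: "s \<in> {-R<..<R}"
        show "((\<lambda>s. F s (y $ k)) has_real_derivative F' s (y $ k)) (at s)"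
          using s R elim by (intro der) auto
        show "\<bar>F' s (y $ k)\<bar> \<le> B" using s elim by (intro B) auto
      qed
    qed
  qed (auto simp: sphere.finite_measure_axioms)
qed

lemma constant_of_derivative_zero:
  assumes "\<And>r::real. \<bar>r\<bar> < 1 \<Longrightarrow> (f has_real_derivative 0) (at r)" "\<bar>r\<bar> < 1"
  shows "f r = f 0"
proof -
  have "\<exists>c. \<forall>x\<in>ball 0 1. f x = c"
    using assms(1) by (intro has_field_derivative_zero_constant)
      (auto intro: has_field_derivative_at_within)
  then show ?thesis using assms(2) by auto
qed

text \<open>The integrand is \<open>cos \<phi> / |y - r e|\<^bsup>n-1\<^esup>\<close>, the solid angle density of the sphere seen from \<open>r e\<close>.\<close>
lemma solid_angle_integral:
  fixes k :: "'n::finite"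
  assumes r: "\<bar>r\<bar> < 1"
  shows "(\<integral>y. (1 - r * y $ k) * sqdist r (y $ k) powr (- real CARD('n) / 2)
    \<partial>(sphere_measure :: (real^'n) measure)) = 1"
proof -
  define \<nu> where "\<nu> = real CARD('n) / 2"
  let ?D = "\<lambda>r t. sqdist r t powr - \<nu>" and ?E = "\<lambda>r t. sqdist r t powr (- \<nu> - 1)"
  let ?F = "\<lambda>r t. (1 - r * t) * ?D r t"
  let ?F' = "\<lambda>r t. - t * ?D r t + (1 - r * t) * (- \<nu> * ?E r t * (2 * r - 2 * t))"
  let ?S = "\<lambda>r. \<integral>y. ?F r (y $ k) \<partial>(sphere_measure :: (real^'n) measure)"
  have "(?S has_real_derivative 0) (at r)" if r: "\<bar>r\<bar> < 1" for r
  proof -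
    have 1: "(?S has_real_derivative (\<integral>y. ?F' r (y $ k) \<partial>(sphere_measure :: (real^'n) measure))) (at r)"
    proof (rule has_real_derivative_sphere_integral[OF r])
      fix r t :: real assume *: "\<bar>r\<bar> < 1" "t \<in> {-1..1}"
      have "((\<lambda>r. 1 - r * t) has_real_derivative - t) (at r)"
        by (auto intro!: derivative_eq_intros)
      from DERIV_mult[OF this DERIV_sqdist_powr_left[OF *, of "- \<nu>"]]
      show "((\<lambda>r. ?F r t) has_real_derivative ?F' r t) (at r)"
        by (simp add: algebra_simps)
    qed (auto intro!: continuous_intros continuous_on_sqdist_powr)
    \<comment> \<open>This choice makes the integrand of \<open>sphere_integral_by_parts\<close>
      agree with \<open>?F'\<close> on the sphere: substitute \<open>?D\<close> =
      \<open>sqdist\<close> * \<open>?E\<close> and n = 2 \<open>\<nu>\<close>.\<close>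
    let ?f = "\<lambda>t. - ?D r t" and ?f' = "\<lambda>t. - (- \<nu> * ?E r t * (- 2 * r))"
    note cont = continuous_on_sqdist_powr_right[OF r]
    have "compact ((\<lambda>t. (?f t, ?f' t)) ` {-1..1})"
      by (intro compact_continuous_image compact_Icc continuous_intros cont)
    then have "bounded ((\<lambda>t. (?f t, ?f' t)) ` {-1..1})" by (rule compact_imp_bounded)
    then obtain B where "\<forall>z\<in>(\<lambda>t. (?f t, ?f' t)) ` {-1..1}. norm z \<le> B"
      unfolding bounded_iff ..
    then have B: "norm (?f t, ?f' t) \<le> B" if "t \<in> {-1..1}" for t
      using that by blast
    have "(\<integral>y. (1 - (y $ k)\<^sup>2) * ?f' (y $ k) - (real CARD('n) - 1) * y $ k * ?f (y $ k)
        \<partial>(sphere_measure :: (real^'n) measure)) = 0"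
    proof (rule sphere_integral_by_parts)
      show "(?f has_real_derivative ?f' t) (at t)" if "t \<in> {-1..1}" for t
        by (intro DERIV_minus DERIV_sqdist_powr_right r that)
      show "\<bar>?f t\<bar> \<le> B" "\<bar>?f' t\<bar> \<le> B" if "t \<in> {-1..1}" for t
        using B[OF that] norm_fst_le[of "?f t" "?f' t"] norm_snd_le[of "?f' t" "?f t"] by simp_all
    qed measurable
    also have "(\<integral>y. (1 - (y $ k)\<^sup>2) * ?f' (y $ k) - (real CARD('n) - 1) * y $ k * ?f (y $ k)
        \<partial>(sphere_measure :: (real^'n) measure)) =
      (\<integral>y. ?F' r (y $ k) \<partial>(sphere_measure :: (real^'n) measure))"
    proof (rule integral_cong_AE)
      show "AE y in (sphere_measure :: (real^'n) measure).
          (1 - (y $ k)\<^sup>2) * ?f' (y $ k) - (real CARD('n) - 1) * y $ k * ?f (y $ k) = ?F' r (y $ k)"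
        using AE_sphere_nth
      proof eventually_elim
        case (elim y)
        define t where "t = y $ k"
        have "t \<in> {-1..1}" using elim by (simp add: t_def)
        then have D: "?D r t = (1 + r\<^sup>2 - 2 * r * t) * ?E r t"
          using sqdist_pos[OF r, of t] powr_mult_base[of "sqdist r t" "- \<nu> - 1"]
          by (simp add: sqdist_def)
        have n: "real CARD('n) = 2 * \<nu>" by (simp add: \<nu>_def)
        show ?case
          unfolding t_def[symmetric] n D by algebra
      qed
    qed measurable
    finally show ?thesis using 1 by simp
  qed
  from constant_of_derivative_zero[of ?S, OF this r]
  have "?S r = ?S 0" .
  also have "?S 0 = 1" by (simp add: sqdist_def sphere.prob_space[simplified])
  finally show ?thesis by (simp add: \<nu>_def)
qed

text \<open>Newton's shell theorem: the potential |x - r y|^(2-n) of a uniform sphere is constant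
  inside. Multiplied by r, the r-derivative of the integrand is (2 - n) times its difference from
  the solid angle density, whose integral is 1; this gives r M' = (2 - n) (M - 1).\<close>

lemma newtonian_potential_integral:
  fixes k :: "'n::finite"
  assumes n: "CARD('n) \<ge> 2" and r: "\<bar>r\<bar> < 1"
  shows "(\<integral>y. sqdist r (y $ k) powr (1 - real CARD('n) / 2) \<partial>(sphere_measure :: (real^'n) measure)) = 1"
proof -
  define \<nu> where "\<nu> = real CARD('n) / 2"
  let ?F = "\<lambda>r t. sqdist r t powr (1 - \<nu>)"
  let ?F' = "\<lambda>r t. (1 - \<nu>) * sqdist r t powr - \<nu> * (2 * r - 2 * t)"
  let ?S = "\<lambda>r t. (1 - r * t) * sqdist r t powr - \<nu>"
  define M where "M r = (\<integral>y. ?F r (y $ k) \<partial>(sphere_measure :: (real^'n) measure))" for r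
  define M' where "M' r = (\<integral>y. ?F' r (y $ k) \<partial>(sphere_measure :: (real^'n) measure))" for r
  have M0: "M 0 = 1" by (simp add: M_def sqdist_def sphere.prob_space[simplified])
  have der: "(M has_real_derivative M' r) (at r)" if r: "\<bar>r\<bar> < 1" for r
    unfolding M_def M'_def
  proof (rule has_real_derivative_sphere_integral[OF r])
    fix r t :: real assume *: "\<bar>r\<bar> < 1" "t \<in> {-1..1}"
    show "((\<lambda>r. ?F r t) has_real_derivative ?F' r t) (at r)"
      using DERIV_sqdist_powr_left[OF *, of "1 - \<nu>"] by simp
  qed (auto intro!: continuous_intros continuous_on_sqdist_powr)
  have ode: "r * M' r = (2 - real CARD('n)) * (M r - 1)" if r: "\<bar>r\<bar> < 1" for r
  proof -
    have int: "integrable (sphere_measure :: (real^'n) measure) (\<lambda>y. G (y $ k))"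
      if [measurable]: "G \<in> borel_measurable borel" and G: "continuous_on {-1..1} G" for G :: "real \<Rightarrow> real"
    proof -
      have "bounded (G ` {-1..1})"
        by (intro compact_imp_bounded compact_continuous_image G compact_Icc)
      then obtain B where B: "\<forall>t\<in>{-1..1}. \<bar>G t\<bar> \<le> B" unfolding bounded_iff by auto
      have "AE y in sphere_measure. \<bar>G ((y :: real^'n) $ k)\<bar> \<le> B"
        using AE_sphere_nth by eventually_elim (use B in blast)
      then show ?thesis by (intro integrable_sphere_bounded) auto
    qed
    note cont = continuous_on_sqdist_powr_right[OF r]
    have I1: "integrable (sphere_measure :: (real^'n) measure) (\<lambda>y. ?F r (y $ k))"
      by (rule int) (auto intro: cont)
    have I2: "integrable (sphere_measure :: (real^'n) measure) (\<lambda>y. ?S r (y $ k))"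
      by (rule int) (auto intro!: continuous_intros cont)
    have "r * M' r = (\<integral>y. r * ?F' r (y $ k) \<partial>(sphere_measure :: (real^'n) measure))"
      unfolding M'_def by simp
    also have "\<dots> = (\<integral>y. (2 - real CARD('n)) * (?F r (y $ k) - ?S r (y $ k)) \<partial>(sphere_measure :: (real^'n) measure))"
    proof (rule integral_cong_AE)
      show "AE y in (sphere_measure :: (real^'n) measure).
          r * ?F' r (y $ k) = (2 - real CARD('n)) * (?F r (y $ k) - ?S r (y $ k))"
        using AE_sphere_nth
      proof eventually_elim
        case (elim y)
        define t where "t = y $ k"
        define E where "E = sqdist r t powr - \<nu>"
        have "t \<in> {-1..1}" using elim by (simp add: t_def)
        then have F: "?F r t = (1 + r\<^sup>2 - 2 * r * t) * E"
          using sqdist_pos[OF r, of t] powr_mult_base[of "sqdist r t" "- \<nu>"]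
          by (simp add: sqdist_def E_def)
        have n: "real CARD('n) = 2 * \<nu>" by (simp add: \<nu>_def)
        show ?case
          unfolding t_def[symmetric] n F E_def[symmetric] by algebra
      qed
    qed measurable
    also have "\<dots> = (2 - real CARD('n)) * (M r - 1)"
      using I1 I2 solid_angle_integral[OF r, of k] by (simp add: M_def \<nu>_def)
    finally show ?thesis .
  qed
  have "M r = 1"
  \<comment> \<open>In the plane the exponent \<open>1 - \<nu>\<close> is 0 and the integrand is 1
    on the sphere.\<close>
  proof (cases "CARD('n) = 2")
    case True
    then have "\<nu> = 1" by (simp add: \<nu>_def)
    have "M r = (\<integral>y. 1 \<partial>(sphere_measure :: (real^'n) measure))"
      unfolding M_def
    proof (rule integral_cong_AE)
      show "AE y in (sphere_measure :: (real^'n) measure). ?F r (y $ k) = 1"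
        using AE_sphere_nth
      proof eventually_elim
        case (elim y)
        then show ?case using sqdist_pos[OF r, of "y $ k"] \<open>\<nu> = 1\<close> by auto
      qed
    qed measurable
    then show ?thesis by (simp add: sphere.prob_space[simplified])
  next
    case False
    \<comment> \<open>r^m is the integrating factor: by the equation r^m (M - 1) has derivative 0,
      and it vanishes at r = 0 because m > 0.\<close>
    define m where "m = CARD('n) - 2"
    have m: "real m = real CARD('n) - 2" "m > 0" using n False by (auto simp: m_def)
    have "((\<lambda>r. r ^ m * (M r - 1)) has_real_derivative 0) (at r)" if r: "\<bar>r\<bar> < 1" for r
    proof -
      have D: "((\<lambda>r. r ^ m * (M r - 1)) has_real_derivative
          real m * r ^ (m - 1) * (M r - 1) + M' r * r ^ m) (at r)"
        by (auto intro!: derivative_eq_intros der[OF r])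
      have "r ^ m = r ^ (m - 1) * r" using m(2) by (metis power_minus_mult)
      then have "real m * r ^ (m - 1) * (M r - 1) + M' r * r ^ m
          = r ^ (m - 1) * (real m * (M r - 1) + r * M' r)" by (simp add: algebra_simps)
      also have "\<dots> = 0" unfolding ode[OF r] m(1) by (simp add: algebra_simps)
      finally show ?thesis using D by simp
    qed
    from constant_of_derivative_zero[of "\<lambda>r. r ^ m * (M r - 1)", OF this r]
    have "r ^ m * (M r - 1) = 0" using m(2) by simp
    then show ?thesis using M0 m(2) by auto
  qed
  then show ?thesis by (simp add: M_def \<nu>_def)
qed

section \<open>Bounds and normalization of the Poisson kernel\<close>

lemma poisson_kernel_sqdist:
  fixes x y :: "real^'n"
  assumes "norm x = 1" "norm y = 1" "\<bar>r\<bar> < 1"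
  shows "poisson_kernel r x y = (1 - r\<^sup>2) * sqdist r (x \<bullet> y) powr (- real CARD('n) / 2)"
proof -
  have "x \<bullet> x = 1" "y \<bullet> y = 1" using assms by (simp_all add: dot_square_norm)
  then have "(x - r *\<^sub>R y) \<bullet> (x - r *\<^sub>R y) = sqdist r (x \<bullet> y)"
    by (simp add: inner_diff_left inner_diff_right inner_commute[of y x] sqdist_def power2_eq_square
        algebra_simps)
  then have n: "norm (x - r *\<^sub>R y) = sqrt (sqdist r (x \<bullet> y))"
    by (simp add: norm_eq_sqrt_inner)
  have "x \<bullet> y \<in> {-1..1}"
    using Cauchy_Schwarz_ineq2[of x y] assms by (simp add: abs_le_iff)
  then have pos: "0 < sqdist r (x \<bullet> y)" by (rule sqdist_pos[OF assms(3)])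
  have "norm (x - r *\<^sub>R y) ^ CARD('n) = sqdist r (x \<bullet> y) powr (real CARD('n) / 2)"
    using pos by (simp add: n powr_half_sqrt[symmetric] powr_power)
  moreover have "sqdist r (x \<bullet> y) powr (- real CARD('n) / 2)
      = inverse (sqdist r (x \<bullet> y) powr (real CARD('n) / 2))"
    by (simp only: powr_minus[symmetric] minus_divide_left)
  ultimately show ?thesis
    unfolding poisson_kernel_def by (simp only: divide_inverse)
qed

lemma measurable_poisson_kernel [measurable]:
  assumes [measurable]: "f \<in> borel_measurable M" "g \<in> borel_measurable M"
  shows "(\<lambda>x. poisson_kernel r (f x) (g x)) \<in> borel_measurable M"
  unfolding poisson_kernel_def by measurable

lemma poisson_kernel_le:
  fixes x y :: "real^'n"
  assumes "norm x = 1" "norm y = 1" "0 \<le> r" "r < 1"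
  shows "0 \<le> poisson_kernel r x y" "poisson_kernel r x y \<le> 1 / (1 - r) ^ CARD('n)"
proof -
  have r2: "r\<^sup>2 \<le> 1" using assms by (simp add: power_le_one)
  show "0 \<le> poisson_kernel r x y" using r2 by (simp add: poisson_kernel_def)
  have "1 - r \<le> norm (x - r *\<^sub>R y)"
    using norm_triangle_ineq2[of x "r *\<^sub>R y"] assms by simp
  then show "poisson_kernel r x y \<le> 1 / (1 - r) ^ CARD('n)"
    unfolding poisson_kernel_def using assms r2
    by (intro frac_le power_mono) auto
qed

lemma integrable_poisson_kernel:
  fixes x :: "real^'n"
  assumes "norm x = 1" "0 \<le> r" "r < 1" and [measurable]: "g \<in> borel_measurable borel"
    and g: "\<And>y. \<bar>g y\<bar> \<le> 1"
  shows "integrable sphere_measure (\<lambda>y. poisson_kernel r x y * g y)"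
proof (rule integrable_sphere_bounded)
  show "AE y in sphere_measure. \<bar>poisson_kernel r x y * g y\<bar> \<le> 1 / (1 - r) ^ CARD('n)"
    using AE_sphere_measure_norm
  proof eventually_elim
    case (elim y)
    have "\<bar>poisson_kernel r x y\<bar> * \<bar>g y\<bar> \<le> 1 / (1 - r) ^ CARD('n) * 1"
      using poisson_kernel_le[OF assms(1) elim assms(2,3)] g[of y] assms(3)
      by (intro mult_mono) auto
    then show ?case by (simp add: abs_mult)
  qed
qed measurable

text \<open>An orthogonal map taking a coordinate axis to \<open>x\<close> reduces the kernel to a
  function of one coordinate, and 1 - r^2 = 2 (1 - r t) - (1 + r^2 - 2 r t) splits it into the two
  integrals already known.\<close>

lemma integral_poisson_kernel:
  fixes x :: "real^'n"
  assumes n: "CARD('n) \<ge> 2" and x: "norm x = 1" and r: "0 \<le> r" "r < 1"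
  shows "(\<integral>y. poisson_kernel r x y \<partial>sphere_measure) = 1"
proof -
  have r': "\<bar>r\<bar> < 1" using r by simp
  define k :: 'n where "k = undefined"
  let ?K = "\<lambda>t. (1 - r\<^sup>2) * sqdist r t powr (- real CARD('n) / 2)"
  let ?S = "\<lambda>t. (1 - r * t) * sqdist r t powr (- real CARD('n) / 2)"
  let ?M = "\<lambda>t. sqdist r t powr (1 - real CARD('n) / 2)"
  have "norm (axis k (1::real)) = norm x" using x by simp
  then obtain T :: "real^'n \<Rightarrow> real^'n" where T: "orthogonal_transformation T" "T (axis k 1) = x"
    by (rule orthogonal_transformation_exists)
  have TT: "x \<bullet> T y = y $ k" for y
    using T by (metis cart_eq_inner_axis inner_commute orthogonal_transformation_def)
  have "(\<integral>y. poisson_kernel r x y \<partial>sphere_measure) = (\<integral>y. poisson_kernel r x (T y) \<partial>sphere_measure)"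
    by (rule integral_sphere_orthogonal[OF T(1), symmetric]) measurable
  also have "\<dots> = (\<integral>y. 2 * ?S (y $ k) - ?M (y $ k) \<partial>(sphere_measure :: (real^'n) measure))"
  proof (rule integral_cong_AE)
    have [measurable]: "T \<in> borel_measurable borel"
      by (rule borel_measurable_orthogonal_transformation[OF T(1)])
    show "(\<lambda>y. poisson_kernel r x (T y)) \<in> borel_measurable sphere_measure" by measurable
    show "AE y in sphere_measure. poisson_kernel r x (T y) = 2 * ?S (y $ k) - ?M (y $ k)"
      using AE_sphere_measure_norm
    proof eventually_elim
      case (elim y)
      have "norm (T y) = 1" using T elim by (simp add: orthogonal_transformation)
      then have K: "poisson_kernel r x (T y) = ?K (y $ k)"
        using poisson_kernel_sqdist[OF x _ r', of "T y"] by (simp add: TT)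
      have "y $ k \<in> {-1..1}"
        using component_le_norm_cart[of y k] elim by (simp add: abs_le_iff)
      then have "?M (y $ k) = (1 + r\<^sup>2 - 2 * r * y $ k) * sqdist r (y $ k) powr (- real CARD('n) / 2)"
        using sqdist_pos[OF r', of "y $ k"] powr_mult_base[of "sqdist r (y $ k)" "- real CARD('n) / 2"]
        by (simp add: sqdist_def)
      then show ?case unfolding K by (simp add: algebra_simps)
    qed
  qed measurable
  also have "\<dots> = 2 * 1 - 1"
  proof (subst Bochner_Integration.integral_diff)
    \<comment> \<open>Integrability is read off from the value: a non-integrable function would have
      integral 0, not 1.\<close>
    show "integrable (sphere_measure :: (real^'n) measure) (\<lambda>y. 2 * ?S (y $ k))"
      using solid_angle_integral[OF r', of k] not_integrable_integral_eq
      by (intro integrable_mult_right) fastforce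
    show "integrable (sphere_measure :: (real^'n) measure) (\<lambda>y. ?M (y $ k))"
      using newtonian_potential_integral[OF n r', of k] not_integrable_integral_eq by fastforce
  qed (use solid_angle_integral[OF r', of k] newtonian_potential_integral[OF n r', of k] in simp)
  finally show ?thesis by simp
qed

lemma noise_op_range:
  fixes x :: "real^'n"
  assumes n: "CARD('n) \<ge> 2" and x: "norm x = 1" and r: "0 \<le> r" "r < 1"
    and [measurable]: "A \<in> sets borel"
  shows "noise_op r (indicator A) x \<in> {0..1}"
proof -
  have "noise_op r (indicator A) x \<le> (\<integral>y. poisson_kernel r x y * 1 \<partial>sphere_measure)"
    unfolding noise_op_def
  proof (rule integral_mono_AE)
    show "AE y in sphere_measure. poisson_kernel r x y * indicator A y \<le> poisson_kernel r x y * 1"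
      using AE_sphere_measure_norm
      by eventually_elim (use poisson_kernel_le[OF x _ r] in \<open>auto split: split_indicator\<close>)
  qed (intro integrable_poisson_kernel x r; simp split: split_indicator)+
  moreover have "0 \<le> noise_op r (indicator A) x"
    unfolding noise_op_def
  proof (rule integral_nonneg_AE)
    show "AE y in sphere_measure. 0 \<le> poisson_kernel r x y * indicator A y"
      using AE_sphere_measure_norm
      by eventually_elim (use poisson_kernel_le[OF x _ r] in \<open>auto split: split_indicator\<close>)
  qed
  ultimately show ?thesis using integral_poisson_kernel[OF n x r] by simp
qed

section \<open>Binary entropy\<close>

text \<open>Both \<open>a\<close> and \<open>b\<close> lie between \<open>d\<close> and
  \<open>c\<close>, and having the same sum they are convex combinations of the two with exchanged
  weights. The two convexity inequalities add up to the claim.\<close>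

lemma convex_on_two_point_spread:
  fixes f :: "real \<Rightarrow> real"
  assumes f: "convex_on S f" and S: "c \<in> S" "d \<in> S" and sum: "a + b = c + d" and le: "a \<le> c" "b \<le> c"
  shows "f a + f b \<le> f c + f d"
proof (cases "c = d")
  case True
  then have "a = c" "b = c" using sum le by linarith+
  then show ?thesis using True by simp
next
  case False
  define t where "t = (a - d) / (c - d)"
  have cd: "c - d > 0" using False sum le by linarith
  have t: "0 \<le> t" "t \<le> 1" using cd sum le by (simp_all add: t_def)
  have "t * (c - d) = a - d" using cd by (simp add: t_def)
  then have "a = (1 - t) *\<^sub>R d + t *\<^sub>R c" "b = (1 - t) *\<^sub>R c + t *\<^sub>R d"
    using sum by (simp_all add: algebra_simps)
  then have "f a \<le> (1 - t) * f d + t * f c" "f b \<le> (1 - t) * f c + t * f d"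
    using convex_onD[OF f t S(2,1)] convex_onD[OF f t S] by simp_all
  then show ?thesis by (simp add: algebra_simps)
qed

text \<open>Convexity in tangent-line form, from ln s \<le> s - 1 at s = z / w. It covers w = 0,
  where the function has no finite slope.\<close>

lemma x_ln_x_ge_tangent:
  fixes w z :: real
  assumes "0 \<le> w" "0 < z"
  shows "z * ln z + (ln z + 1) * (w - z) \<le> w * ln w"
proof (cases "w = 0")
  case False
  then have w: "0 < w" using assms by simp
  then have "w * ln (z / w) \<le> w * (z / w - 1)"
    using assms by (intro mult_left_mono ln_le_minus_one) auto
  also have "ln (z / w) = ln z - ln w" using assms w by (simp add: ln_div)
  finally show ?thesis using w by (simp add: algebra_simps)
qed (simp add: algebra_simps assms less_imp_le)

lemma convex_on_x_ln_x: "convex_on {0..} (\<lambda>x::real. x * ln x)"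
proof (rule convex_onI)
  fix t x y :: real assume t: "0 < t" "t < 1" and xy: "x \<in> {0..}" "y \<in> {0..}"
  define z where "z = (1 - t) * x + t * y"
  have "z * ln z \<le> (1 - t) * (x * ln x) + t * (y * ln y)"
  proof (cases "z = 0")
    case True
    then have "(1 - t) * x = 0" "t * y = 0"
      using t xy by (auto simp: z_def add_nonneg_eq_0_iff)
    then show ?thesis using True t by simp
  next
    case False
    then have z: "0 < z" using t xy by (simp add: z_def order_neq_le_trans)
    \<comment> \<open>Average of the tangent inequalities at \<open>z\<close>; the linear parts
      cancel because \<open>z\<close> is the mean.\<close>
    have "(1 - t) * (z * ln z + (ln z + 1) * (x - z)) + t * (z * ln z + (ln z + 1) * (y - z))
        \<le> (1 - t) * (x * ln x) + t * (y * ln y)"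
      using t xy z by (intro add_mono mult_left_mono x_ln_x_ge_tangent) auto
    also have "(1 - t) * (z * ln z + (ln z + 1) * (x - z)) + t * (z * ln z + (ln z + 1) * (y - z))
        = z * ln z + (ln z + 1) * ((1 - t) * x + t * y - z)"
      by (simp add: algebra_simps)
    finally show ?thesis by (simp add: z_def)
  qed
  then show "((1 - t) *\<^sub>R x + t *\<^sub>R y) * ln ((1 - t) *\<^sub>R x + t *\<^sub>R y)
      \<le> (1 - t) * (x * ln x) + t * (y * ln y)" by (simp add: z_def)
qed (rule convex_real_interval)

text \<open>Applying ln s \<le> s - 1 to s = 1 / sqrt x gives -ln x \<le> 2 / sqrt x. This controls
  the function at the endpoint 0, where continuity does not follow from that of
  \<open>ln\<close>.\<close>

lemma abs_x_ln_x_le: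
  fixes x :: real assumes "0 \<le> x" "x \<le> 1"
  shows "\<bar>x * ln x\<bar> \<le> 2 * sqrt x"
proof (cases "x = 0")
  case False
  then have x: "0 < x" using assms by simp
  have "- ln (sqrt x) = ln (1 / sqrt x)" using x by (simp add: ln_div)
  also have "\<dots> \<le> 1 / sqrt x - 1" using x by (intro ln_le_minus_one) auto
  also have "\<dots> \<le> 1 / sqrt x" by simp
  finally have "x * - ln x \<le> x * (2 / sqrt x)"
    using x by (intro mult_left_mono) (auto simp: ln_sqrt)
  also have "x * (2 / sqrt x) = 2 * sqrt x" using x by (simp add: field_simps flip: power2_eq_square)
  finally have "- (x * ln x) \<le> 2 * sqrt x" by simp
  moreover have "x * ln x \<le> 0" using x assms by (intro mult_nonneg_nonpos) auto
  ultimately show ?thesis by simp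
qed simp

lemma continuous_on_x_ln_x: "continuous_on {0..1} (\<lambda>x::real. x * ln x)"
  unfolding continuous_on_def
proof
  fix x :: real assume x: "x \<in> {0..1}"
  show "((\<lambda>x. x * ln x) \<longlongrightarrow> x * ln x) (at x within {0..1})"
  proof (cases "x = 0")
    case True
    have "((\<lambda>x::real. x * ln x) \<longlongrightarrow> 0) (at 0 within {0..1})"
    proof (rule Lim_null_comparison)
      show "eventually (\<lambda>x::real. norm (x * ln x) \<le> 2 * sqrt x) (at 0 within {0..1})"
        using abs_x_ln_x_le by (auto simp: eventually_at_filter intro!: always_eventually)
      show "((\<lambda>x. 2 * sqrt x) \<longlongrightarrow> 0) (at 0 within {0..1})"
        by (rule tendsto_eq_intros | simp)+
    qed
    then show ?thesis using True by simp
  qed (use x in \<open>auto intro!: tendsto_intros\<close>)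
qed

lemma bin_entropy_eq:
  assumes "x \<in> {0..1}"
  shows "bin_entropy x = - (x * ln x + (1 - x) * ln (1 - x)) / ln 2"
proof -
  have "u * log 2 (1 / u) = - (u * ln u) / ln 2" if "0 \<le> u" for u :: real
    using that by (cases "u = 0") (simp_all add: log_def ln_div)
  from this[of x] this[of "1 - x"] assms show ?thesis
    by (simp add: bin_entropy_def diff_divide_distrib add_divide_distrib)
qed

text \<open>Up to the factor 1 / ln 2 the entropy is minus a sum of two convex functions. In the
  second one the roles of the larger and smaller point are exchanged: 1 - d is the maximum.\<close>

lemma bin_entropy_two_point_spread:
  assumes "a + b = c + d" "a \<le> c" "b \<le> c" and cd: "c \<in> {0..1}" "d \<in> {0..1}"
  shows "bin_entropy c + bin_entropy d \<le> bin_entropy a + bin_entropy b"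
proof -
  have ab: "a \<in> {0..1}" "b \<in> {0..1}" using assms by auto
  have "a * ln a + b * ln b \<le> c * ln c + d * ln d"
    using assms by (intro convex_on_two_point_spread[OF convex_on_x_ln_x]) auto
  moreover have "(1 - a) * ln (1 - a) + (1 - b) * ln (1 - b) \<le> (1 - d) * ln (1 - d) + (1 - c) * ln (1 - c)"
    using assms by (intro convex_on_two_point_spread[OF convex_on_x_ln_x]) auto
  ultimately show ?thesis
    unfolding bin_entropy_eq[OF ab(1)] bin_entropy_eq[OF ab(2)] bin_entropy_eq[OF cd(1)]
      bin_entropy_eq[OF cd(2)] add_divide_distrib[symmetric]
    by (intro divide_right_mono) auto
qed

lemma continuous_on_bin_entropy: "continuous_on {0..1} bin_entropy"
proof -
  have "continuous_on {0..1} (\<lambda>x::real. (1 - x) * ln (1 - x))"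
    by (rule continuous_on_compose2[OF continuous_on_x_ln_x]) (auto intro!: continuous_intros)
  then have "continuous_on {0..1} (\<lambda>x::real. - (x * ln x + (1 - x) * ln (1 - x)) / ln 2)"
    by (intro continuous_on_divide continuous_on_minus continuous_on_add continuous_on_x_ln_x
        continuous_on_const) auto
  then show ?thesis by (rule continuous_on_eq) (simp only: bin_entropy_eq)
qed

lemma measurable_bin_entropy [measurable]: "bin_entropy \<in> borel_measurable borel"
  unfolding bin_entropy_def[abs_def] by measurable

section \<open>Polarization\<close>

text \<open>Also known as two-point symmetrization. The reflection fixes its hyperplane, so both
  branches agree there, and for \<open>u = 0\<close> the set is unchanged.\<close>

definition polarization :: "real^'n \<Rightarrow> (real^'n) set \<Rightarrow> (real^'n) set" where
  "polarization u A = {x. if 0 \<le> u \<bullet> x then x \<in> A \<or> reflection u x \<in> A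
    else x \<in> A \<and> reflection u x \<in> A}"

lemma sets_polarization [measurable]:
  assumes [measurable]: "A \<in> sets borel" shows "polarization u A \<in> sets borel"
  unfolding polarization_def by measurable

lemma polarization_reflection_vimage: "polarization u (reflection u -` A) = polarization u A"
  by (auto simp: polarization_def)

lemma mem_polarization_cases:
  shows "0 < u \<bullet> x \<Longrightarrow> x \<in> polarization u A \<longleftrightarrow> x \<in> A \<or> reflection u x \<in> A"
    and "0 < u \<bullet> x \<Longrightarrow> reflection u x \<in> polarization u A \<longleftrightarrow> x \<in> A \<and> reflection u x \<in> A"
    and "u \<bullet> x = 0 \<Longrightarrow> x \<in> polarization u A \<longleftrightarrow> x \<in> A"
  by (auto simp: polarization_def inner_reflection reflection_eq_self)

text \<open>Used for comparisons that are symmetric in a point and its mirror image, so that only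
  the open side of \<open>u\<close> and the hyperplane need a calculation.\<close>

lemma sign_cases_reflection:
  assumes "\<And>x. u \<bullet> x = 0 \<Longrightarrow> P x" "\<And>x. 0 < u \<bullet> x \<Longrightarrow> P x"
    and "\<And>x. 0 < u \<bullet> x \<Longrightarrow> P x \<Longrightarrow> P (reflection u x)"
  shows "P x"
proof (cases "u \<bullet> x" "0 :: real" rule: linorder_cases)
  case less
  then have "0 < u \<bullet> reflection u x" by (simp add: inner_reflection)
  from assms(3)[OF this assms(2)[OF this]] show ?thesis by simp
qed (use assms in auto)

lemma indicator_polarization_sum:
  "indicator (polarization u A) x + indicator (polarization u A) (reflection u x)
    = (indicator A x + indicator A (reflection u x) :: real)"
proof (rule sign_cases_reflection[where u = u and P = "\<lambda>x. indicator (polarization u A) x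
    + indicator (polarization u A) (reflection u x)
    = (indicator A x + indicator A (reflection u x) :: real)"])
  fix x assume x: "0 < u \<bullet> x"
  then show "indicator (polarization u A) x + indicator (polarization u A) (reflection u x)
    = (indicator A x + indicator A (reflection u x) :: real)"
    by (simp add: mem_polarization_cases indicator_def)
qed (simp_all add: mem_polarization_cases reflection_eq_self indicator_def add.commute)

text \<open>By reflection invariance an integral is half the integral of the sums over mirror pairs.
  Inequalities between integrals are proved pair by pair in this form below.\<close>

lemma sphere_integral_reflection_sum:
  fixes F :: "real^'n \<Rightarrow> real"
  assumes [measurable]: "F \<in> borel_measurable borel" and B: "\<And>x. norm x = 1 \<Longrightarrow> \<bar>F x\<bar> \<le> B"
  shows "(\<integral>x. F x + F (reflection u x) \<partial>sphere_measure) = 2 * (\<integral>x. F x \<partial>sphere_measure)"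
    and "integrable sphere_measure F"
    and "integrable sphere_measure (\<lambda>x. F x + F (reflection u x))"
proof -
  have "AE x in sphere_measure. \<bar>F x\<bar> \<le> B"
    using AE_sphere_measure_norm by eventually_elim (rule B)
  then show 1: "integrable sphere_measure F" by (intro integrable_sphere_bounded) auto
  have "AE x in sphere_measure. \<bar>F (reflection u x)\<bar> \<le> B"
    using AE_sphere_measure_norm by eventually_elim (simp add: B)
  then have 2: "integrable sphere_measure (\<lambda>x. F (reflection u x))"
    by (intro integrable_sphere_bounded) auto
  show "integrable sphere_measure (\<lambda>x. F x + F (reflection u x))" using 1 2 by simp
  have "(\<integral>x. F (reflection u x) \<partial>sphere_measure) = (\<integral>x. F x \<partial>sphere_measure)"
    by (rule integral_sphere_orthogonal[OF orthogonal_transformation_reflection]) measurable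
  then show "(\<integral>x. F x + F (reflection u x) \<partial>sphere_measure) = 2 * (\<integral>x. F x \<partial>sphere_measure)"
    using 1 2 by simp
qed

lemma measure_polarization:
  assumes [measurable]: "A \<in> sets borel"
  shows "measure sphere_measure (polarization u A) = measure sphere_measure A"
proof -
  have *: "(\<integral>x. indicator B x + indicator B (reflection u x) \<partial>sphere_measure) = 2 * measure sphere_measure B"
    if [measurable]: "B \<in> sets borel" for B
  proof -
    have "(\<integral>x. (indicator B x + indicator B (reflection u x) :: real) \<partial>sphere_measure)
        = 2 * (\<integral>x. indicator B x \<partial>sphere_measure)"
      by (rule sphere_integral_reflection_sum(1)[where B = 1]) (auto split: split_indicator)
    then show ?thesis by simp
  qed
  from *[of "polarization u A"] *[of A] show ?thesis
    by (simp add: indicator_polarization_sum)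
qed

section \<open>The noise operator under polarization\<close>

lemma poisson_kernel_reflection:
  "poisson_kernel r (reflection u x) (reflection u y) = poisson_kernel r x y"
proof -
  have "reflection u x - r *\<^sub>R reflection u y = reflection u (x - r *\<^sub>R y)"
    by (simp add: linear_diff[OF linear_reflection] linear_cmul[OF linear_reflection])
  then show ?thesis by (simp add: poisson_kernel_def)
qed

text \<open>For x and y on the same side, reflecting y does not increase x . y, so the distance in
  the denominator does not decrease.\<close>

lemma poisson_kernel_reflection_le:
  fixes x y :: "real^'n"
  assumes "norm x = 1" "norm y = 1" and r: "0 \<le> r" "r < 1" and u: "0 \<le> (u \<bullet> x) * (u \<bullet> y)"
  shows "poisson_kernel r x (reflection u y) \<le> poisson_kernel r x y"
proof -
  have "0 \<le> 2 * (u \<bullet> y) * (u \<bullet> x) / (u \<bullet> u)"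
    using u by (intro divide_nonneg_nonneg) (simp_all add: mult.commute)
  then have "x \<bullet> reflection u y \<le> x \<bullet> y" by (simp add: inner_reflection_right)
  then have "r * (x \<bullet> reflection u y) \<le> r * (x \<bullet> y)" using r by (intro mult_left_mono)
  then have "(x - r *\<^sub>R y) \<bullet> (x - r *\<^sub>R y) \<le> (x - r *\<^sub>R reflection u y) \<bullet> (x - r *\<^sub>R reflection u y)"
    by (simp add: inner_diff_left inner_diff_right inner_reflection_both
        inner_commute[of y x] inner_commute[of "reflection u y" x] algebra_simps)
  then have le: "norm (x - r *\<^sub>R y) \<le> norm (x - r *\<^sub>R reflection u y)"
    by (simp add: norm_eq_sqrt_inner)
  have "1 - r \<le> norm (x - r *\<^sub>R y)"
    using norm_triangle_ineq2[of x "r *\<^sub>R y"] assms by simp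
  then have pos: "0 < norm (x - r *\<^sub>R y)" using r by linarith
  have "r\<^sup>2 \<le> 1" using r by (simp add: power_le_one)
  then show ?thesis
    unfolding poisson_kernel_def using le pos
    by (intro divide_left_mono power_mono mult_pos_pos zero_less_power) auto
qed

lemma measurable_noise_op [measurable]:
  assumes [measurable]: "g \<in> borel_measurable borel"
  shows "noise_op r g \<in> borel_measurable borel"
  unfolding noise_op_def[abs_def] by measurable

lemma noise_op_reflection:
  assumes [measurable]: "g \<in> borel_measurable borel"
  shows "noise_op r g (reflection u x) = noise_op r (\<lambda>y. g (reflection u y)) x"
proof -
  have "noise_op r g (reflection u x)
      = (\<integral>y. poisson_kernel r (reflection u x) (reflection u y) * g (reflection u y) \<partial>sphere_measure)"
    unfolding noise_op_def
    by (rule integral_sphere_orthogonal[OF orthogonal_transformation_reflection, symmetric]) measurable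
  then show ?thesis by (simp add: poisson_kernel_reflection noise_op_def)
qed

text \<open>In each mirror pair the point on the side of x has the larger kernel weight, and if only
  one point of the pair is in the set, polarization puts it there.\<close>

lemma noise_op_polarization_ge:
  fixes x :: "real^'n"
  assumes x: "norm x = 1" and r: "0 \<le> r" "r < 1" and u: "0 \<le> u \<bullet> x"
    and [measurable]: "A \<in> sets borel"
  shows "noise_op r (indicator A) x \<le> noise_op r (indicator (polarization u A)) x"
proof -
  let ?G = "\<lambda>A y. poisson_kernel r x y * (indicator A y :: real)"
  have bound: "\<bar>?G B y\<bar> \<le> 1 / (1 - r) ^ CARD('n)" if "norm y = 1" for B y
    using poisson_kernel_le[OF x that r] r by (auto split: split_indicator)
  note sum_integral = sphere_integral_reflection_sum(1)[OF _ bound, where u = u]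
    and sum_integrable = sphere_integral_reflection_sum(3)[OF _ bound, where u = u]
  have "?G A y + ?G A (reflection u y) \<le> ?G (polarization u A) y + ?G (polarization u A) (reflection u y)"
    if "norm y = 1" for y
  proof -
    let ?P = "\<lambda>y. norm y = 1 \<longrightarrow> ?G A y + ?G A (reflection u y)
      \<le> ?G (polarization u A) y + ?G (polarization u A) (reflection u y)"
    have "?P y"
    proof (rule sign_cases_reflection[where u = u and P = ?P])
      fix y assume y: "0 < u \<bullet> y"
      show "?P y"
      proof
        assume "norm y = 1"
        then have "poisson_kernel r x (reflection u y) \<le> poisson_kernel r x y"
          using u y by (intro poisson_kernel_reflection_le x r) auto
        then show "?G A y + ?G A (reflection u y)
            \<le> ?G (polarization u A) y + ?G (polarization u A) (reflection u y)"
          using y by (simp add: mem_polarization_cases indicator_def)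
      qed
    qed (simp_all add: mem_polarization_cases reflection_eq_self indicator_def add.commute)
    then show ?thesis using that by simp
  qed
  then have "(\<integral>y. ?G A y + ?G A (reflection u y) \<partial>sphere_measure)
      \<le> (\<integral>y. ?G (polarization u A) y + ?G (polarization u A) (reflection u y) \<partial>sphere_measure)"
    using AE_sphere_measure_norm
    by (intro integral_mono_AE sum_integrable) (measurable, auto elim: eventually_mono)
  moreover have "(\<integral>y. ?G B y + ?G B (reflection u y) \<partial>sphere_measure) = 2 * noise_op r (indicator B) x"
    if [measurable]: "B \<in> sets borel" for B
    unfolding noise_op_def by (rule sum_integral) measurable
  ultimately show ?thesis by simp
qed

text \<open>Lets the lower bound at \<open>x\<close> also control the value at the mirror image:
  reflecting the set instead of the point leaves its polarization unchanged.\<close>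

lemma noise_op_indicator_vimage_reflection:
  assumes [measurable]: "A \<in> sets borel"
  shows "noise_op r (indicator (reflection u -` A)) x = noise_op r (indicator A) (reflection u x)"
proof -
  have "(\<lambda>y. indicator A (reflection u y) :: real) = indicator (reflection u -` A)"
    by (auto simp: indicator_def)
  then show ?thesis using noise_op_reflection[of "indicator A" r u x] by simp
qed

lemma noise_op_polarization_sum:
  fixes x :: "real^'n"
  assumes x: "norm x = 1" and r: "0 \<le> r" "r < 1" and [measurable]: "A \<in> sets borel"
  shows "noise_op r (indicator (polarization u A)) x + noise_op r (indicator (polarization u A)) (reflection u x)
    = noise_op r (indicator A) x + noise_op r (indicator A) (reflection u x)"
proof -
  have "noise_op r (indicator B) x + noise_op r (indicator B) (reflection u x)
      = (\<integral>y. poisson_kernel r x y * (indicator B y + indicator B (reflection u y)) \<partial>sphere_measure)"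
    if [measurable]: "B \<in> sets borel" for B
  proof -
    have "integrable sphere_measure (\<lambda>y. poisson_kernel r x y * indicator B y)"
      by (rule integrable_poisson_kernel[OF x r]) (auto split: split_indicator)
    moreover have "(\<lambda>y. indicator B (reflection u y) :: real) \<in> borel_measurable borel"
      by measurable
    then have "integrable sphere_measure (\<lambda>y. poisson_kernel r x y * indicator B (reflection u y))"
      by (rule integrable_poisson_kernel[OF x r]) (auto split: split_indicator)
    ultimately show ?thesis
      unfolding noise_op_reflection[OF borel_measurable_indicator[OF that]]
      by (simp add: noise_op_def distrib_left)
  qed
  then show ?thesis by (simp add: indicator_polarization_sum)
qed

text \<open>On the side of \<open>u\<close> the polarized value at \<open>x\<close> dominates both
  original values, and the sum over the pair is preserved, so the polarized pair is the more spread
  out one.\<close>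

lemma bin_entropy_noise_op_polarization:
  fixes x :: "real^'n"
  assumes n: "CARD('n) \<ge> 2" and x: "norm x = 1" and r: "0 \<le> r" "r < 1"
    and [measurable]: "A \<in> sets borel"
  shows "bin_entropy (noise_op r (indicator (polarization u A)) x)
      + bin_entropy (noise_op r (indicator (polarization u A)) (reflection u x))
    \<le> bin_entropy (noise_op r (indicator A) x) + bin_entropy (noise_op r (indicator A) (reflection u x))"
    (is "?l x \<le> ?r x")
proof -
  have "norm x = 1 \<longrightarrow> ?l x \<le> ?r x"
  proof (rule sign_cases_reflection[where u = u and P = "\<lambda>x. norm x = 1 \<longrightarrow> ?l x \<le> ?r x"])
    fix x assume "0 < u \<bullet> x" "norm x = 1 \<longrightarrow> ?l x \<le> ?r x"
    then show "norm (reflection u x) = 1 \<longrightarrow> ?l (reflection u x) \<le> ?r (reflection u x)"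
      by (simp add: add.commute)
  next
    have *: "norm x = 1 \<longrightarrow> ?l x \<le> ?r x" if u: "0 \<le> u \<bullet> x" for x
    proof
      assume x: "norm x = 1"
      have "reflection u \<in> borel_measurable borel"
        by (rule borel_measurable_orthogonal_transformation[OF orthogonal_transformation_reflection])
      then have V [measurable]: "reflection u -` A \<in> sets borel"
        using measurable_sets[of "reflection u" borel borel A] by simp
      show "?l x \<le> ?r x"
      proof (rule bin_entropy_two_point_spread)
        show "noise_op r (indicator A) x \<le> noise_op r (indicator (polarization u A)) x"
          by (rule noise_op_polarization_ge[OF x r u]) measurable
        show "noise_op r (indicator A) (reflection u x) \<le> noise_op r (indicator (polarization u A)) x"
          using noise_op_polarization_ge[OF x r u V]
          by (simp add: noise_op_indicator_vimage_reflection polarization_reflection_vimage)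
      qed (use noise_op_polarization_sum[OF x r, where A = A and u = u] x in
          \<open>auto intro!: noise_op_range[OF n _ r] simp del: atLeastAtMost_iff\<close>)
    qed
    show "norm x = 1 \<longrightarrow> ?l x \<le> ?r x" if "0 < u \<bullet> x" for x using *[of x] that by simp
    show "norm x = 1 \<longrightarrow> ?l x \<le> ?r x" if "u \<bullet> x = 0" for x using *[of x] that by simp
  qed
  then show ?thesis using x by simp
qed

lemma bin_entropy_bounded: "\<exists>B. \<forall>x\<in>{0..1}. \<bar>bin_entropy x\<bar> \<le> B"
proof -
  have "bounded (bin_entropy ` {0..1})"
    by (intro compact_imp_bounded compact_continuous_image continuous_on_bin_entropy compact_Icc)
  then show ?thesis unfolding bounded_iff by auto
qed

lemma cond_entropy_polarization_le:
  fixes A :: "(real^'n) set"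
  assumes n: "CARD('n) \<ge> 2" and r: "0 \<le> r" "r < 1" and [measurable]: "A \<in> sets borel"
  shows "cond_entropy r (indicator (polarization u A)) \<le> cond_entropy r (indicator A)"
proof -
  let ?h = "\<lambda>A x. bin_entropy (noise_op r (indicator A) x)"
  obtain B where B: "\<forall>x\<in>{0..1}. \<bar>bin_entropy x\<bar> \<le> B" using bin_entropy_bounded by blast
  have bound: "\<bar>?h A x\<bar> \<le> B" if "A \<in> sets borel" "norm x = 1" for A and x :: "real^'n"
    using B noise_op_range[OF n that(2) r that(1)] by blast
  have m: "?h A \<in> borel_measurable borel" if [measurable]: "A \<in> sets borel" for A :: "(real^'n) set" by measurable
  note sum_integral = sphere_integral_reflection_sum(1)[OF m bound, where u = u]
    and sum_integrable = sphere_integral_reflection_sum(3)[OF m bound, where u = u]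
  have "AE x in sphere_measure. ?h (polarization u A) x + ?h (polarization u A) (reflection u x)
      \<le> ?h A x + ?h A (reflection u x)"
    using AE_sphere_measure_norm
    by eventually_elim (rule bin_entropy_noise_op_polarization[OF n _ r], auto)
  then have "(\<integral>x. ?h (polarization u A) x + ?h (polarization u A) (reflection u x) \<partial>sphere_measure)
      \<le> (\<integral>x. ?h A x + ?h A (reflection u x) \<partial>sphere_measure)"
    by (intro integral_mono_AE sum_integrable) auto
  then show ?thesis by (simp add: sum_integral cond_entropy_def)
qed

section \<open>Approximating the cap by iterated polarization\<close>

text \<open>Since a . u \<ge> 0, if one point of a mirror pair is in the cap, so is the one on the
  side of \<open>u\<close>. Hence no pair gains set points outside \<open>C\<close>, and a pair with
  one point in \<open>A - C\<close> and the other in \<open>C - A\<close> loses one.\<close>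

lemma cap_deficit_polarization:
  fixes a u :: "real^'n"
  assumes au: "0 \<le> a \<bullet> u" and C: "C = {x. t \<le> a \<bullet> x}" and [measurable]: "A \<in> sets borel"
  shows "measure sphere_measure (polarization u A - C)
    + measure sphere_measure {x \<in> A - C. reflection u x \<in> C - A} \<le> measure sphere_measure (A - C)"
proof -
  have [measurable]: "C \<in> sets borel" unfolding C by measurable
  let ?G = "{x \<in> A - C. reflection u x \<in> C - A}"
  let ?L = "\<lambda>x. indicator (polarization u A - C) x + indicator ?G x :: real"
  let ?R = "\<lambda>x. indicator (A - C) x :: real"
  have "?L x + ?L (reflection u x) \<le> ?R x + ?R (reflection u x)" for x
  proof (rule sign_cases_reflection[where u = u and
        P = "\<lambda>x. ?L x + ?L (reflection u x) \<le> ?R x + ?R (reflection u x)"])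
    fix x assume x: "0 < u \<bullet> x"
    have "0 \<le> 2 * (u \<bullet> x) * (u \<bullet> a) / (u \<bullet> u)"
      using x au by (intro divide_nonneg_nonneg mult_nonneg_nonneg) (auto simp: inner_commute)
    then have "x \<in> C" if "reflection u x \<in> C"
      using that by (simp add: C inner_reflection_right)
    then show "?L x + ?L (reflection u x) \<le> ?R x + ?R (reflection u x)"
      using x by (auto simp: mem_polarization_cases indicator_def)
  next
    fix x assume "u \<bullet> x = 0"
    then show "?L x + ?L (reflection u x) \<le> ?R x + ?R (reflection u x)"
      by (auto simp: mem_polarization_cases reflection_eq_self indicator_def)
  qed (simp add: add.commute)
  moreover have bound: "\<bar>?L x\<bar> \<le> 2" "\<bar>?R x\<bar> \<le> 1" for x by (auto simp: indicator_def)
  have m: "?L \<in> borel_measurable borel" "?R \<in> borel_measurable borel" by measurable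
  note L = sphere_integral_reflection_sum[OF m(1) bound(1)]
    and R = sphere_integral_reflection_sum[OF m(2) bound(2)]
  ultimately have "(\<integral>x. ?L x + ?L (reflection u x) \<partial>sphere_measure)
      \<le> (\<integral>x. ?R x + ?R (reflection u x) \<partial>sphere_measure)"
    by (intro integral_mono L(3) R(3))
  then have "(\<integral>x. ?L x \<partial>sphere_measure) \<le> (\<integral>x. ?R x \<partial>sphere_measure)"
    unfolding L(1) R(1) by simp
  moreover have "(\<integral>x. ?L x \<partial>sphere_measure) = measure sphere_measure (polarization u A - C)
      + measure sphere_measure ?G"
    by (subst Bochner_Integration.integral_add) (auto intro!: integrable_sphere_bounded[where B = 1])
  ultimately show ?thesis by simp
qed

text \<open>By Fubini the average over \<open>u\<close> is the integral over x in \<open>A\<close>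
  of the chance that x is reflected into \<open>B\<close>, hence at least m(A) m(B) / c with c the
  constant of \<open>sphere_measure_le_reflecting_directions\<close>. Halving this bound makes the
  inequality strict.\<close>

lemma exists_reflection_exchanging:
  fixes A B :: "(real^'n) set"
  assumes n: "CARD('n) \<ge> 2" and [measurable]: "A \<in> sets borel" "B \<in> sets borel"
    and pos: "0 < measure sphere_measure A * measure sphere_measure B"
  shows "\<exists>u. measure sphere_measure A * measure sphere_measure B / (2 * (fact CARD('n) * 6 ^ CARD('n)))
    < measure sphere_measure {x \<in> A. reflection u x \<in> B}"
proof (rule ccontr)
  define c :: real where "c = fact CARD('n) * 6 ^ CARD('n)"
  have c: "0 < c" by (simp add: c_def)
  let ?m = "measure sphere_measure A * measure sphere_measure B"
  assume "\<not> ?thesis"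
  then have small: "measure sphere_measure {x \<in> A. reflection u x \<in> B} \<le> ?m / (2 * c)" for u
    by (auto simp: not_less c_def)
  interpret pair_prob_space "sphere_measure :: (real^'n) measure" "sphere_measure :: (real^'n) measure"
    by unfold_locales
  define f :: "real^'n \<Rightarrow> real^'n \<Rightarrow> real" where
    "f x u = indicator A x * indicator B (reflection u x)" for x u
  have fm [measurable]: "case_prod f \<in> borel_measurable (sphere_measure \<Otimes>\<^sub>M sphere_measure)"
    unfolding f_def[abs_def] by measurable
  have int: "integrable (sphere_measure \<Otimes>\<^sub>M sphere_measure) (case_prod f)"
    by (rule P.integrable_const_bound[where B = 1])
      (auto simp: f_def[abs_def] split: split_indicator)
  have fu: "(\<integral>x. f x u \<partial>sphere_measure) = measure sphere_measure {x \<in> A. reflection u x \<in> B}" for u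
  proof -
    have "(\<lambda>x. f x u) = indicator {x \<in> A. reflection u x \<in> B}"
      by (auto simp: f_def indicator_def)
    then show ?thesis by simp
  qed
  have fx: "(\<integral>u. f x u \<partial>sphere_measure) = indicator A x * measure sphere_measure {u. reflection u x \<in> B}" for x
  proof -
    have "f x = (\<lambda>u. indicator A x * indicator {u. reflection u x \<in> B} u)"
      by (auto simp: f_def indicator_def)
    then show ?thesis by simp
  qed
  have "?m / c = (\<integral>x. indicator A x * (measure sphere_measure B / c) \<partial>sphere_measure)" by simp
  also have "\<dots> \<le> (\<integral>x. (\<integral>u. f x u \<partial>sphere_measure) \<partial>sphere_measure)"
  proof (rule integral_mono_AE)
    show "integrable sphere_measure (\<lambda>x. \<integral>u. f x u \<partial>sphere_measure)"
      using integrable_fst'[OF int] by simp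
    show "AE x in sphere_measure. indicator A x * (measure sphere_measure B / c) \<le> (\<integral>u. f x u \<partial>sphere_measure)"
      using AE_sphere_measure_norm
    proof eventually_elim
      case (elim x)
      have "measure sphere_measure B / c \<le> measure sphere_measure {u. reflection u x \<in> B}"
        using sphere_measure_le_reflecting_directions[OF n elim, of B] c
        by (simp add: c_def divide_le_eq mult.commute)
      then show ?case unfolding fx by (intro mult_left_mono) auto
    qed
    have "integrable sphere_measure (indicator A :: real^'n \<Rightarrow> real)"
      by (rule integrable_sphere_bounded[where B = 1]) auto
    then show "integrable sphere_measure (\<lambda>x. indicator A x * (measure sphere_measure B / c))"
      by (rule integrable_mult_left)
  qed
  also have "\<dots> = (\<integral>u. (\<integral>x. f x u \<partial>sphere_measure) \<partial>sphere_measure)"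
    by (rule Fubini_integral[OF int, symmetric])
  also have "\<dots> \<le> (\<integral>u. ?m / (2 * c) \<partial>(sphere_measure :: (real^'n) measure))"
    using integrable_snd[OF int] small by (intro integral_mono) (auto simp: fu)
  also have "\<dots> = ?m / (2 * c)" by (simp add: sphere.prob_space[simplified])
  finally show False using pos c by (simp add: field_simps)
qed

text \<open>Equal total measure gives \<open>A - C\<close> and \<open>C - A\<close> the same
  measure, which is where the square comes from.\<close>

lemma exists_improving_polarization:
  fixes a :: "real^'n" and A C :: "(real^'n) set"
  assumes n: "CARD('n) \<ge> 2" and C: "C = {x. t \<le> a \<bullet> x}" and [measurable]: "A \<in> sets borel"
    and eq: "measure sphere_measure A = measure sphere_measure C"
    and pos: "0 < measure sphere_measure (A - C)"
  shows "\<exists>u. measure sphere_measure (polarization u A - C)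
    < measure sphere_measure (A - C)
      - (measure sphere_measure (A - C))\<^sup>2 / (2 * (fact CARD('n) * 6 ^ CARD('n)))"
proof -
  have [measurable]: "C \<in> sets borel" unfolding C by measurable
  have CA: "measure sphere_measure (C - A) = measure sphere_measure (A - C)"
    using eq sphere.finite_measure_Diff'[of A C] sphere.finite_measure_Diff'[of C A]
    by (simp add: Int_commute)
  obtain u where u: "(measure sphere_measure (A - C))\<^sup>2 / (2 * (fact CARD('n) * 6 ^ CARD('n)))
    < measure sphere_measure {x \<in> A - C. reflection u x \<in> C - A}"
    using exists_reflection_exchanging[OF n, of "A - C" "C - A"] pos
    by (auto simp: CA power2_eq_square)
  \<comment> \<open>A reflection does not see the sign of its normal, so \<open>u\<close> can be
    turned towards the cap, as \<open>cap_deficit_polarization\<close> asks.\<close>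
  define v where "v = (if 0 \<le> a \<bullet> u then u else - u)"
  have "0 \<le> a \<bullet> v" "reflection v = reflection u" by (auto simp: v_def)
  then show ?thesis
    using cap_deficit_polarization[of a v C t A] u C by (intro exI[of _ v]) simp
qed

text \<open>Iteration is replaced by an infimum: \<open>d\<close> is the least deficit over all sets
  of the right measure with entropy at most that of \<open>A\<close>, a class closed under
  polarization.\<close>

lemma exists_polarization_approximation:
  fixes a :: "real^'n" and A C :: "(real^'n) set"
  assumes n: "CARD('n) \<ge> 2" and C: "C = {x. t \<le> a \<bullet> x}" and [measurable]: "A \<in> sets borel"
    and eq: "measure sphere_measure A = measure sphere_measure C"
    and r: "0 \<le> r" "r < 1" and e: "0 < e"
  shows "\<exists>A'. A' \<in> sets borel \<and> measure sphere_measure A' = measure sphere_measure C \<and>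
    cond_entropy r (indicator A') \<le> cond_entropy r (indicator A) \<and> measure sphere_measure (A' - C) < e"
proof -
  define c :: real where "c = 2 * (fact CARD('n) * 6 ^ CARD('n))"
  have c: "0 < c" by (simp add: c_def)
  define \<A> :: "(real^'n) set set" where "\<A> = {A' \<in> sets borel. measure sphere_measure A' = measure sphere_measure C \<and>
    cond_entropy r (indicator A') \<le> cond_entropy r (indicator A)}"
  define d where "d = (INF A'\<in>\<A>. measure sphere_measure (A' - C))"
  have "A \<in> \<A>" by (simp add: \<A>_def eq)
  have bdd: "bdd_below ((\<lambda>A'. measure sphere_measure (A' - C)) ` \<A>)"
    by (rule bdd_belowI[of _ 0]) auto
  have d_le: "d \<le> measure sphere_measure (A' - C)" if "A' \<in> \<A>" for A'
    unfolding d_def using bdd that by (rule cINF_lower)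
  have d_approx: "\<exists>A'\<in>\<A>. measure sphere_measure (A' - C) < y" if "d < y" for y
    using that \<open>A \<in> \<A>\<close> bdd unfolding d_def by (subst (asm) cINF_less_iff) auto
  have "d \<le> 0"
  proof (rule ccontr)
    assume "\<not> d \<le> 0"
    then have d: "0 < d" by simp
    \<comment> \<open>The margin d^2 / c is the gain guaranteed at any deficit of at least
      \<open>d\<close>, so one polarization takes such a set below \<open>d\<close>, against the
      choice of \<open>d\<close>.\<close>
    then have "d < d + d\<^sup>2 / c" using c by simp
    from d_approx[OF this] obtain B where B: "B \<in> \<A>" "measure sphere_measure (B - C) < d + d\<^sup>2 / c"
      by blast
    have [measurable]: "B \<in> sets borel" using B by (simp add: \<A>_def)
    have dB: "d \<le> measure sphere_measure (B - C)" using d_le B by simp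
    obtain u where u: "measure sphere_measure (polarization u B - C)
        < measure sphere_measure (B - C) - (measure sphere_measure (B - C))\<^sup>2 / c"
      using exists_improving_polarization[OF n C, of B] B dB d by (auto simp: \<A>_def c_def)
    have "polarization u B \<in> \<A>"
      using B cond_entropy_polarization_le[OF n r, of B u]
      by (auto simp: \<A>_def measure_polarization)
    then have "d \<le> measure sphere_measure (polarization u B - C)" by (rule d_le)
    moreover have "d\<^sup>2 / c \<le> (measure sphere_measure (B - C))\<^sup>2 / c"
      using dB d c by (intro divide_right_mono power_mono) auto
    ultimately show False using u B(2) by linarith
  qed
  then show ?thesis using d_approx[of e] e by (auto simp: \<A>_def)
qed

section \<open>Continuity of the entropy and passage to the limit\<close>

text \<open>The two integrands differ only on the symmetric difference, where the kernel is at most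
  (1 - r)^(-n).\<close>

lemma noise_op_indicator_diff_le:
  fixes x :: "real^'n"
  assumes x: "norm x = 1" and r: "0 \<le> r" "r < 1" and [measurable]: "A \<in> sets borel" "B \<in> sets borel"
  shows "\<bar>noise_op r (indicator A) x - noise_op r (indicator B) x\<bar>
    \<le> (measure sphere_measure (A - B) + measure sphere_measure (B - A)) / (1 - r) ^ CARD('n)"
proof -
  let ?K = "poisson_kernel r x"
  have int: "integrable sphere_measure (\<lambda>y. ?K y * indicator S y)" if [measurable]: "S \<in> sets borel" for S
    by (rule integrable_poisson_kernel[OF x r]) (auto split: split_indicator)
  have "\<bar>noise_op r (indicator A) x - noise_op r (indicator B) x\<bar>
      = \<bar>\<integral>y. ?K y * indicator A y - ?K y * indicator B y \<partial>sphere_measure\<bar>"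
    unfolding noise_op_def using int by (subst Bochner_Integration.integral_diff) auto
  also have "\<dots> \<le> (\<integral>y. \<bar>?K y * indicator A y - ?K y * indicator B y\<bar> \<partial>sphere_measure)"
    by (rule integral_abs_bound)
  also have "\<dots> \<le> (\<integral>y. (indicator (A - B) y + indicator (B - A) y) / (1 - r) ^ CARD('n) \<partial>sphere_measure)"
  proof (rule integral_mono_AE)
    show "integrable sphere_measure (\<lambda>y. \<bar>?K y * indicator A y - ?K y * indicator B y\<bar>)"
      using int by (intro integrable_abs Bochner_Integration.integrable_diff) auto
    show "integrable sphere_measure
        (\<lambda>y. (indicator (A - B) y + indicator (B - A) y) / (1 - r) ^ CARD('n) :: real)"
      by (intro integrable_divide Bochner_Integration.integrable_add integrable_sphere_bounded[where B = 1])
        auto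
    show "AE y in sphere_measure. \<bar>?K y * indicator A y - ?K y * indicator B y\<bar>
        \<le> (indicator (A - B) y + indicator (B - A) y) / (1 - r) ^ CARD('n)"
      using AE_sphere_measure_norm
    proof eventually_elim
      case (elim y)
      show ?case using poisson_kernel_le[OF x elim r] by (auto simp: indicator_def)
    qed
  qed
  also have "\<dots> = (measure sphere_measure (A - B) + measure sphere_measure (B - A)) / (1 - r) ^ CARD('n)"
    by (simp, subst Bochner_Integration.integral_add) (auto intro!: integrable_sphere_bounded[where B = 1])
  finally show ?thesis .
qed

text \<open>For sets of deficit below 1 / (i + 1) the noise operators converge at each point of the
  sphere. The entropy is bounded and continuous on [0, 1], so dominated convergence carries the
  inequality over to the cap.\<close>

lemma cond_entropy_cap_le:
  fixes a :: "real^'n" and A C :: "(real^'n) set"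
  assumes n: "CARD('n) \<ge> 2" and C: "C = {x. t \<le> a \<bullet> x}" and A [measurable]: "A \<in> sets borel"
    and eq: "measure sphere_measure A = measure sphere_measure C"
    and r: "0 \<le> r" "r < 1"
  shows "cond_entropy r (indicator C) \<le> cond_entropy r (indicator A)"
proof -
  have mC [measurable]: "C \<in> sets borel" unfolding C by measurable
  have "\<forall>i. \<exists>A'. A' \<in> sets borel \<and> measure sphere_measure A' = measure sphere_measure C \<and>
    cond_entropy r (indicator A') \<le> cond_entropy r (indicator A) \<and>
    measure sphere_measure (A' - C) < 1 / real (Suc i)"
    by (intro allI exists_polarization_approximation[OF n C A eq r]) simp
  then obtain S where S [measurable]: "\<And>i. S i \<in> sets borel"
    and S_eq: "\<And>i. measure sphere_measure (S i) = measure sphere_measure C"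
    and S_le: "\<And>i. cond_entropy r (indicator (S i)) \<le> cond_entropy r (indicator A)"
    and S_lim: "\<And>i. measure sphere_measure (S i - C) < 1 / real (Suc i)"
    by metis
  have CS: "measure sphere_measure (C - S i) = measure sphere_measure (S i - C)" for i
    using S_eq[of i] sphere.finite_measure_Diff'[of "S i" C] sphere.finite_measure_Diff'[of C "S i"]
    by (simp add: Int_commute)
  obtain B where B: "\<forall>x\<in>{0..1}. \<bar>bin_entropy x\<bar> \<le> B" using bin_entropy_bounded by blast
  have "(\<lambda>i. cond_entropy r (indicator (S i))) \<longlonglongrightarrow> cond_entropy r (indicator C)"
    unfolding cond_entropy_def
  proof (rule integral_dominated_convergence[where w = "\<lambda>_. B"])
    show "AE x in sphere_measure. (\<lambda>i. bin_entropy (noise_op r (indicator (S i)) x))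
        \<longlonglongrightarrow> bin_entropy (noise_op r (indicator C) x)"
      using AE_sphere_measure_norm
    proof eventually_elim
      case (elim x)
      have "(\<lambda>i. noise_op r (indicator (S i)) x - noise_op r (indicator C) x) \<longlonglongrightarrow> 0"
      proof (rule Lim_null_comparison)
        show "eventually (\<lambda>i. norm (noise_op r (indicator (S i)) x - noise_op r (indicator C) x)
            \<le> 2 / (1 - r) ^ CARD('n) * (1 / real (Suc i))) sequentially"
        proof (intro always_eventually allI)
          fix i
          have "norm (noise_op r (indicator (S i)) x - noise_op r (indicator C) x)
              \<le> (2 * measure sphere_measure (S i - C)) / (1 - r) ^ CARD('n)"
            using noise_op_indicator_diff_le[OF elim r S[of i] mC] by (simp add: CS)
          also have "\<dots> \<le> (2 * (1 / real (Suc i))) / (1 - r) ^ CARD('n)"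
            using S_lim[of i] r by (intro divide_right_mono) auto
          finally show "norm (noise_op r (indicator (S i)) x - noise_op r (indicator C) x)
              \<le> 2 / (1 - r) ^ CARD('n) * (1 / real (Suc i))" by (simp add: field_simps)
        qed
        show "(\<lambda>i. 2 / (1 - r) ^ CARD('n) * (1 / real (Suc i))) \<longlonglongrightarrow> 0"
          by (intro tendsto_mult_right_zero LIMSEQ_Suc lim_1_over_n)
      qed
      then have "(\<lambda>i. noise_op r (indicator (S i)) x) \<longlonglongrightarrow> noise_op r (indicator C) x"
        by (rule LIM_zero_cancel)
      then show ?case
        by (rule continuous_on_tendsto_compose[OF continuous_on_bin_entropy])
          (auto intro!: noise_op_range[OF n elim r] always_eventually simp del: atLeastAtMost_iff)
    qed
    show "AE x in sphere_measure. norm (bin_entropy (noise_op r (indicator (S i)) x)) \<le> B" for i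
      using AE_sphere_measure_norm
      by eventually_elim (use B noise_op_range[OF n _ r S[of i]] in auto)
  qed auto
  then show ?thesis by (rule LIMSEQ_le_const2) (use S_le in auto)
qed

theorem theorem3:
  fixes f :: "real^'n \<Rightarrow> real" and \<rho> :: real and \<eta> :: "(real^'n) set"
  assumes "CARD('n) \<ge> 2"
    and "f \<in> borel_measurable borel"
    and "\<forall>x\<in>sphere 0 1. f x \<in> {0, 1}"
    and "0 \<le> \<rho>" and "\<rho> < 1"
    and "halfspace \<eta>"
    and "(\<integral>x. indicator \<eta> x \<partial>sphere_measure) = (\<integral>x. f x \<partial>sphere_measure)"
  shows "- cond_entropy \<rho> f \<le> - cond_entropy \<rho> (indicator \<eta>)"
proof -
  note [measurable] = assms(2)
  obtain a t where \<eta>: "\<eta> = {x. t \<le> a \<bullet> x}" using assms(6) by (auto simp: halfspace_def)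
  \<comment> \<open>Off the sphere \<open>f\<close> may take any value; replacing it by the
    indicator of \<open>A\<close> alters it on a null set only, so all integrals stay the
    same.\<close>
  define A where "A = {x. f x = 1}"
  have A [measurable]: "A \<in> sets borel" unfolding A_def by measurable
  have f: "AE x in sphere_measure. f x = indicator A x"
    using AE_sphere_measure_norm
    by eventually_elim (use assms(3) in \<open>auto simp: A_def indicator_def\<close>)
  have "noise_op \<rho> f x = noise_op \<rho> (indicator A) x" for x
    unfolding noise_op_def by (rule integral_cong_AE) (use f in \<open>auto elim: eventually_mono\<close>)
  then have "cond_entropy \<rho> f = cond_entropy \<rho> (indicator A)" by (simp add: cond_entropy_def)
  moreover have "(\<integral>x. f x \<partial>sphere_measure) = (\<integral>x. indicator A x \<partial>sphere_measure)"
    by (rule integral_cong_AE) (use f in auto)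
  then have "measure sphere_measure A = measure sphere_measure \<eta>" using assms(7) by simp
  ultimately show ?thesis
    using cond_entropy_cap_le[OF assms(1) \<eta> A _ assms(4,5)] by simp
qed

end
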